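(* Let $\Omega$ be an open, bounded, connected subset of $\mathbb{R}^n$ such that $c[\Omega]<+\infty$, let $\alpha\in(0,1]$ and $m\in\mathbb{N}\setminus\{0\}$. Let $\mathcal{K}\subseteq C^{m,\alpha}(\mathrm{cl}\,\Omega)$. Then the following conditions are equivalent. (i) The set $\mathcal{K}$ is relatively compact in $\left(C^{m,\alpha}(\mathrm{cl}\,\Omega),\|\cdot\|_{m,\alpha}\right)$. (ii) The set $\mathcal{K}$ is bounded in $\left(C^{m,\alpha}(\mathrm{cl}\,\Omega),\|\cdot\|_{m,\alpha}\right)$, and for all $\epsilon>0$ there exists a finite covering $\mathcal{F}$ of $(\Omega\times\Omega)\setminus\Delta$ by open subsets $F$ of $(\Omega\times\Omega)\setminus\Delta$ such that $\mathrm{diam}\left(S[D^{\eta}k](F)\right)<\epsilon$ for all $F\in\mathcal{F}$, all $k\in\mathcal{K}$, and all $\eta\in\mathbb{N}^n$ with $|\eta|=m$.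
   Context: $\mathrm{cl}\,\Omega$ denotes the closure of $\Omega$ in $\mathbb{R}^n$, $\Delta=\{(\mathbf{x},\mathbf{x}):\mathbf{x}\in\mathbb{R}^n\}$, and $\mathbb{N}$ includes $0$. All functions are real-valued. For $\eta=(\eta_1,\dots,\eta_n)\in\mathbb{N}^n$, $|\eta|=\eta_1+\dots+\eta_n$ and $D^\eta=\frac{\partial^{|\eta|}}{\partial x_1^{\eta_1}\cdots\partial x_n^{\eta_n}}$. $C^m(\mathrm{cl}\,\Omega)$ is the space of $m$-times continuously differentiable functions $f$ on $\Omega$ such that $D^\eta f$ has a continuous extension to $\mathrm{cl}\,\Omega$ for all $|\eta|\le m$ (the extensions are denoted by the same symbols), with norm $\|f\|_m=\sum_{|\eta|\le m}\sup_{\mathrm{cl}\,\Omega}|D^\eta f|$. For a function $f$ on $\mathrm{cl}\,\Omega$, its Hölder quotient is $|f|_\alpha=\sup\left\{\frac{|f(\mathbf{x})-f(\mathbf{y})|}{|\mathbf{x}-\mathbf{y}|^\alpha}:\mathbf{x},\mathbf{y}\in\mathrm{cl}\,\Omega,\ \mathbf{x}\neq\mathbf{y}\right\}$. $C^{m,\alpha}(\mathrm{cl}\,\Omega)$ is the subspace of those $f\in C^m(\mathrm{cl}\,\Omega)$ whose derivatives of order $m$ are Hölder continuous with exponent $\alpha$ (i.e. $|D^\eta f|_\alpha<+\infty$ for $|\eta|=m$), with norm $\|f\|_{m,\alpha}=\|f\|_m+\sum_{|\eta|=m}|D^\eta f|_\alpha$. For $g\in C^{0,\alpha}(\mathrm{cl}\,\Omega)$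 (continuous functions on $\mathrm{cl}\,\Omega$ with $|g|_\alpha<+\infty$), $S[g]$ is the function on $(\Omega\times\Omega)\setminus\Delta$ given by $S[g](\mathbf{x},\mathbf{y})=\frac{g(\mathbf{x})-g(\mathbf{y})}{|\mathbf{x}-\mathbf{y}|^\alpha}$. For $\Omega$ open and connected and $\mathbf{x},\mathbf{y}\in\Omega$, the geodesic distance $\lambda(\mathbf{x},\mathbf{y})$ is the infimum of the lengths of the arcs $\gamma:[0,1]\to\Omega$ of class $C^1$ with $\gamma(0)=\mathbf{x}$, $\gamma(1)=\mathbf{y}$, and $c[\Omega]=\sup\left\{\lambda(\mathbf{x},\mathbf{y})\,|\mathbf{x}-\mathbf{y}|^{-1}:\mathbf{x},\mathbf{y}\in\Omega,\ \mathbf{x}\neq\mathbf{y}\right\}$. A subset of a Banach space is relatively compact if its closure is compact. $\mathrm{diam}\,A$ is the diameter of a set $A$. *)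

theory Defs
  imports "HOL-Analysis.Analysis"
begin

section \<open>Partial derivatives and multi-indices\<close>

definition partial_deriv :: "'n \<Rightarrow> (real ^ 'n \<Rightarrow> real) \<Rightarrow> real ^ 'n \<Rightarrow> real" where
  "partial_deriv i f = (\<lambda>x. deriv (\<lambda>t. f (x + t *\<^sub>R axis i 1)) 0)"

definition multi_order :: "('n::finite \<Rightarrow> nat) \<Rightarrow> nat" where
  "multi_order \<eta> = (\<Sum>i\<in>UNIV. \<eta> i)"

text \<open>The index type carries no order, so an arbitrary enumeration of the coordinates is fixed.
  It only determines in which order the partial derivatives are taken, and this is immaterial for
  functions of class C^m and multi-indices of order at most m, to which \<open>partial_D\<close> is applied.\<close>

definition coords :: "'n::finite list" where
  "coords = (SOME xs. distinct xs \<and> set xs = UNIV)"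

definition partial_D :: "('n::finite \<Rightarrow> nat) \<Rightarrow> (real ^ 'n \<Rightarrow> real) \<Rightarrow> real ^ 'n \<Rightarrow> real" where
  "partial_D \<eta> f = foldr (\<lambda>i. partial_deriv i ^^ \<eta> i) coords f"

primrec cont_diff_on :: "nat \<Rightarrow> (real ^ 'n) set \<Rightarrow> (real ^ 'n \<Rightarrow> real) \<Rightarrow> bool" where
  "cont_diff_on 0 \<Omega> f \<longleftrightarrow> continuous_on \<Omega> f"
| "cont_diff_on (Suc m) \<Omega> f \<longleftrightarrow>
     (\<forall>x\<in>\<Omega>. f differentiable (at x)) \<and> (\<forall>i. cont_diff_on m \<Omega> (partial_deriv i f))"


section \<open>Schauder spaces\<close>

definition is_cl_extension :: "'a::topological_space set \<Rightarrow> ('a \<Rightarrow> real) \<Rightarrow> ('a \<Rightarrow> real) \<Rightarrow> bool" where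
  "is_cl_extension \<Omega> f g \<longleftrightarrow> continuous_on (closure \<Omega>) g \<and> (\<forall>x\<in>\<Omega>. g x = f x)"

text \<open>The derivative of multi-index \<open>\<eta>\<close>, continuously extended to the closure; it is determined
  only on the closure.\<close>

definition cl_D :: "(real ^ 'n::finite) set \<Rightarrow> ('n \<Rightarrow> nat) \<Rightarrow> (real ^ 'n \<Rightarrow> real) \<Rightarrow> real ^ 'n \<Rightarrow> real" where
  "cl_D \<Omega> \<eta> f = (SOME g. is_cl_extension \<Omega> (partial_D \<eta> f) g)"

text \<open>A function on \<open>\<Omega>\<close> is identified with its continuous extension to the closure. Elements are
  extensional, so that equality of HOL functions is equality on the closure.\<close>

definition C_space :: "nat \<Rightarrow> (real ^ 'n::finite) set \<Rightarrow> (real ^ 'n \<Rightarrow> real) set" where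
  "C_space m \<Omega> = {f \<in> extensional (closure \<Omega>).
     continuous_on (closure \<Omega>) f \<and> cont_diff_on m \<Omega> f \<and>
     (\<forall>\<eta>. multi_order \<eta> \<le> m \<longrightarrow> (\<exists>g. is_cl_extension \<Omega> (partial_D \<eta> f) g))}"

text \<open>Suprema and norms take values in \<^typ>\<open>ennreal\<close>: finiteness is then meaningful, and the
  supremum over the empty set is 0.\<close>

definition hoelder_quotient :: "real \<Rightarrow> 'a::real_normed_vector set \<Rightarrow> ('a \<Rightarrow> real) \<Rightarrow> ennreal" where
  "hoelder_quotient \<alpha> A f =
     (SUP (x, y)\<in>{(x, y). x \<in> A \<and> y \<in> A \<and> x \<noteq> y}. ennreal (\<bar>f x - f y\<bar> / norm (x - y) powr \<alpha>))"

definition C_norm :: "nat \<Rightarrow> (real ^ 'n::finite) set \<Rightarrow> (real ^ 'n \<Rightarrow> real) \<Rightarrow> ennreal" where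
  "C_norm m \<Omega> f = (\<Sum>\<eta> | multi_order \<eta> \<le> m. SUP x\<in>closure \<Omega>. ennreal \<bar>cl_D \<Omega> \<eta> f x\<bar>)"

definition schauder_space :: "nat \<Rightarrow> real \<Rightarrow> (real ^ 'n::finite) set \<Rightarrow> (real ^ 'n \<Rightarrow> real) set" where
  "schauder_space m \<alpha> \<Omega> = {f \<in> C_space m \<Omega>.
     \<forall>\<eta>. multi_order \<eta> = m \<longrightarrow> hoelder_quotient \<alpha> (closure \<Omega>) (cl_D \<Omega> \<eta> f) < \<infinity>}"

definition schauder_norm :: "nat \<Rightarrow> real \<Rightarrow> (real ^ 'n::finite) set \<Rightarrow> (real ^ 'n \<Rightarrow> real) \<Rightarrow> ennreal" where
  "schauder_norm m \<alpha> \<Omega> f = C_norm m \<Omega> f +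
     (\<Sum>\<eta> | multi_order \<eta> = m. hoelder_quotient \<alpha> (closure \<Omega>) (cl_D \<Omega> \<eta> f))"

text \<open>The metric of the norm. The locale \<^locale>\<open>Metric_space\<close> asks for symmetry on the whole
  type, hence the value 0 off the space.\<close>

definition schauder_dist ::
    "nat \<Rightarrow> real \<Rightarrow> (real ^ 'n::finite) set \<Rightarrow> (real ^ 'n \<Rightarrow> real) \<Rightarrow> (real ^ 'n \<Rightarrow> real) \<Rightarrow> real" where
  "schauder_dist m \<alpha> \<Omega> f g =
     (if f \<in> schauder_space m \<alpha> \<Omega> \<and> g \<in> schauder_space m \<alpha> \<Omega>
      then enn2real (schauder_norm m \<alpha> \<Omega> (\<lambda>x\<in>closure \<Omega>. f x - g x)) else 0)"

abbreviation schauder_topology ::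
    "nat \<Rightarrow> real \<Rightarrow> (real ^ 'n::finite) set \<Rightarrow> (real ^ 'n \<Rightarrow> real) topology" where
  "schauder_topology m \<alpha> \<Omega> \<equiv>
     Metric_space.mtopology (schauder_space m \<alpha> \<Omega>) (schauder_dist m \<alpha> \<Omega>)"

definition relatively_compact_in :: "'a topology \<Rightarrow> 'a set \<Rightarrow> bool" where
  "relatively_compact_in X K \<longleftrightarrow> compactin X (X closure_of K)"

definition schauder_bounded ::
    "nat \<Rightarrow> real \<Rightarrow> (real ^ 'n::finite) set \<Rightarrow> (real ^ 'n \<Rightarrow> real) set \<Rightarrow> bool" where
  "schauder_bounded m \<alpha> \<Omega> K \<longleftrightarrow> (SUP k\<in>K. schauder_norm m \<alpha> \<Omega> k) < \<infinity>"


section \<open>Difference quotients and geodesic distance\<close>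

definition off_diagonal :: "'a set \<Rightarrow> ('a \<times> 'a) set" where
  "off_diagonal \<Omega> = \<Omega> \<times> \<Omega> - {(x, x) | x. True}"

definition hoelder_diff :: "real \<Rightarrow> ('a::real_normed_vector \<Rightarrow> real) \<Rightarrow> 'a \<times> 'a \<Rightarrow> real" where
  "hoelder_diff \<alpha> g = (\<lambda>(x, y). (g x - g y) / norm (x - y) powr \<alpha>)"

text \<open>The derivatives at the end points of the unit interval are one-sided.\<close>

definition C1_arc :: "(real \<Rightarrow> 'a::real_normed_vector) \<Rightarrow> bool" where
  "C1_arc \<gamma> \<longleftrightarrow> (\<exists>\<gamma>'. continuous_on {0..1} \<gamma>' \<and>
     (\<forall>t\<in>{0..1}. (\<gamma> has_vector_derivative \<gamma>' t) (at t within {0..1})))"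

definition arc_len :: "(real \<Rightarrow> 'a::real_normed_vector) \<Rightarrow> real" where
  "arc_len \<gamma> = integral {0..1} (\<lambda>t. norm (vector_derivative \<gamma> (at t within {0..1})))"

definition geodesic_dist :: "'a::real_normed_vector set \<Rightarrow> 'a \<Rightarrow> 'a \<Rightarrow> ennreal" where
  "geodesic_dist \<Omega> x y =
     (INF \<gamma>\<in>{\<gamma>. C1_arc \<gamma> \<and> path_image \<gamma> \<subseteq> \<Omega> \<and> pathstart \<gamma> = x \<and> pathfinish \<gamma> = y}.
        ennreal (arc_len \<gamma>))"

definition geodesic_const :: "'a::real_normed_vector set \<Rightarrow> ennreal" where
  "geodesic_const \<Omega> =
     (SUP (x, y)\<in>{(x, y). x \<in> \<Omega> \<and> y \<in> \<Omega> \<and> x \<noteq> y}.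
        geodesic_dist \<Omega> x y * ennreal (inverse (norm (x - y))))"


section \<open>The Schauder distance is a metric\<close>

lemma partial_deriv_cong:
  assumes "open \<Omega>" "x \<in> \<Omega>" "\<And>y. y \<in> \<Omega> \<Longrightarrow> f y = g y"
  shows "partial_deriv i f x = partial_deriv i g x"
proof -
  have "((\<lambda>t. x + t *\<^sub>R axis i 1) \<longlongrightarrow> x + 0 *\<^sub>R axis i 1) (nhds (0::real))"
    by (intro tendsto_intros) (simp add: filterlim_ident)
  then have "eventually (\<lambda>t. x + t *\<^sub>R axis i 1 \<in> \<Omega>) (nhds (0::real))"
    using assms(1,2) by (auto simp: tendsto_def)
  then have "eventually (\<lambda>t. f (x + t *\<^sub>R axis i 1) = g (x + t *\<^sub>R axis i 1)) (nhds (0::real))"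
    by eventually_elim (simp add: assms(3))
  then show ?thesis
    unfolding partial_deriv_def by (intro deriv_cong_ev) auto
qed

lemma partial_deriv_line:
  assumes "f differentiable (at x)"
  shows "((\<lambda>t. f (x + t *\<^sub>R axis i 1)) has_field_derivative partial_deriv i f x) (at 0)"
proof -
  obtain f' where f': "(f has_derivative f') (at x)"
    using assms by (auto simp: differentiable_def)
  have "((\<lambda>t. x + t *\<^sub>R axis i 1) has_derivative (\<lambda>t. t *\<^sub>R axis i 1)) (at (0::real))"
    by (auto intro!: derivative_eq_intros)
  then have "((\<lambda>t. f (x + t *\<^sub>R axis i 1)) has_derivative (\<lambda>t. f' (t *\<^sub>R axis i 1))) (at (0::real))"
    using f' has_derivative_compose[of "\<lambda>t. x + t *\<^sub>R axis i 1" _ 0 UNIV f f'] by simp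
  moreover have "(\<lambda>t. f' (t *\<^sub>R axis i 1)) = (*) (f' (axis i 1))"
    using f' has_derivative_bounded_linear linear_simps(5) by fastforce
  ultimately have "((\<lambda>t. f (x + t *\<^sub>R axis i 1)) has_field_derivative f' (axis i 1)) (at 0)"
    by (simp add: has_field_derivative_def)
  then show ?thesis
    unfolding partial_deriv_def using DERIV_imp_deriv by fastforce
qed

lemma partial_deriv_lincomb:
  assumes "f differentiable (at x)" "g differentiable (at x)"
  shows "partial_deriv i (\<lambda>x. a * f x + b * g x) x = a * partial_deriv i f x + b * partial_deriv i g x"
proof -
  have "((\<lambda>t. a * f (x + t *\<^sub>R axis i 1) + b * g (x + t *\<^sub>R axis i 1)) has_field_derivative
      a * partial_deriv i f x + b * partial_deriv i g x) (at 0)"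
    by (intro DERIV_add DERIV_cmult partial_deriv_line assms)
  then show ?thesis
    unfolding partial_deriv_def using DERIV_imp_deriv by blast
qed

lemma cont_diff_on_cong:
  assumes "open \<Omega>" "\<And>x. x \<in> \<Omega> \<Longrightarrow> f x = g x"
  shows "cont_diff_on m \<Omega> f \<longleftrightarrow> cont_diff_on m \<Omega> g"
  using assms(2)
proof (induction m arbitrary: f g)
  case 0
  then show ?case by (auto cong: continuous_on_cong)
next
  case (Suc m)
  have "f differentiable (at x) \<longleftrightarrow> g differentiable (at x)" if "x \<in> \<Omega>" for x
    using has_derivative_transform_within_open[OF _ assms(1) that, where f = f and g = g]
      has_derivative_transform_within_open[OF _ assms(1) that, where f = g and g = f] Suc.prems
    unfolding differentiable_def by metis
  moreover have "cont_diff_on m \<Omega> (partial_deriv i f) \<longleftrightarrow> cont_diff_on m \<Omega> (partial_deriv i g)" for i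
    by (rule Suc.IH) (use partial_deriv_cong[OF assms(1)] Suc.prems in blast)
  ultimately show ?case by auto
qed

lemma cont_diff_on_lincomb:
  assumes "open \<Omega>" "cont_diff_on m \<Omega> f" "cont_diff_on m \<Omega> g"
  shows "cont_diff_on m \<Omega> (\<lambda>x. a * f x + b * g x)"
  using assms(2,3)
proof (induction m arbitrary: f g)
  case 0
  then show ?case by (auto intro!: continuous_intros)
next
  case (Suc m)
  have "cont_diff_on m \<Omega> (partial_deriv i (\<lambda>x. a * f x + b * g x))" for i
    using Suc by (subst cont_diff_on_cong[OF assms(1) partial_deriv_lincomb]) auto
  then show ?case
    using Suc.prems by (auto intro!: derivative_intros)
qed

lemma cont_diff_on_Suc_D: "cont_diff_on (Suc m) \<Omega> f \<Longrightarrow> cont_diff_on m \<Omega> f"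
proof (induction m arbitrary: f)
  case 0
  then show ?case
    by (auto simp: continuous_on_eq_continuous_within intro: differentiable_imp_continuous_within
        differentiable_at_withinI)
next
  case (Suc m)
  have "cont_diff_on m \<Omega> (partial_deriv i f)" for i
    by (rule Suc.IH) (use Suc.prems in simp)
  then show ?case
    using Suc.prems by simp
qed

lemma cont_diff_on_mono: "cont_diff_on m \<Omega> f \<Longrightarrow> k \<le> m \<Longrightarrow> cont_diff_on k \<Omega> f"
  by (induction m) (use cont_diff_on_Suc_D le_Suc_eq in blast)+

lemma coords: "distinct (coords :: 'n::finite list)" "set (coords :: 'n list) = UNIV"
proof -
  have "\<exists>xs :: 'n list. distinct xs \<and> set xs = UNIV"
    using finite_distinct_list[of "UNIV :: 'n set"] by auto
  then have "distinct (coords :: 'n list) \<and> set (coords :: 'n list) = UNIV"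
    unfolding coords_def by (rule someI_ex)
  then show "distinct (coords :: 'n list)" "set (coords :: 'n list) = UNIV" by auto
qed

lemma partial_D_foldr:
  fixes \<eta> :: "'n::finite \<Rightarrow> nat"
  obtains js where "length js = multi_order \<eta>" "\<And>f. partial_D \<eta> f = foldr partial_deriv js f"
proof
  define js where "js = concat (map (\<lambda>i. replicate (\<eta> i) i) (coords :: 'n list))"
  have "length js = sum_list (map \<eta> coords)"
    by (simp add: js_def length_concat comp_def)
  then show "length js = multi_order \<eta>"
    by (simp add: multi_order_def sum_list_distinct_conv_sum_set coords)
  have *: "foldr partial_deriv (replicate k i) f = (partial_deriv i ^^ k) f" for k and i :: 'n and f
    by (induction k) auto
  have "foldr partial_deriv (concat (map (\<lambda>i. replicate (\<eta> i) i) ks)) f =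
      foldr (\<lambda>i. partial_deriv i ^^ \<eta> i) ks f" for ks f
    by (induction ks) (auto simp: *)
  then show "partial_D \<eta> f = foldr partial_deriv js f" for f
    by (simp add: partial_D_def js_def)
qed

lemma foldr_partial_deriv_cong:
  assumes "open \<Omega>" "\<And>x. x \<in> \<Omega> \<Longrightarrow> f x = g x" "x \<in> \<Omega>"
  shows "foldr partial_deriv js f x = foldr partial_deriv js g x"
  using assms(3)
proof (induction js arbitrary: x)
  case Nil
  then show ?case using assms(2) by simp
next
  case (Cons j js)
  then show ?case
    using partial_deriv_cong[OF assms(1) Cons.prems Cons.IH] by simp
qed

lemma partial_D_cong:
  assumes "open \<Omega>" "\<And>x. x \<in> \<Omega> \<Longrightarrow> f x = g x" "x \<in> \<Omega>"
  shows "partial_D \<eta> f x = partial_D \<eta> g x"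
proof -
  obtain js where js: "\<And>f. partial_D \<eta> f = foldr partial_deriv js f"
    using partial_D_foldr[of \<eta>] by metis
  show ?thesis
    unfolding js by (rule foldr_partial_deriv_cong[OF assms])
qed

lemma partial_D_lincomb:
  assumes "open \<Omega>" "cont_diff_on m \<Omega> f" "cont_diff_on m \<Omega> g" "multi_order \<eta> \<le> m" "x \<in> \<Omega>"
  shows "partial_D \<eta> (\<lambda>x. a * f x + b * g x) x = a * partial_D \<eta> f x + b * partial_D \<eta> g x"
proof -
  obtain js where js: "length js = multi_order \<eta>" "\<And>f. partial_D \<eta> f = foldr partial_deriv js f"
    using partial_D_foldr[of \<eta>] by metis
  have "\<forall>x\<in>\<Omega>. foldr partial_deriv js (\<lambda>x. a * f x + b * g x) x =
      a * foldr partial_deriv js f x + b * foldr partial_deriv js g x"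
    if "cont_diff_on (length js) \<Omega> f" "cont_diff_on (length js) \<Omega> g"
    using that
  proof (induction js arbitrary: f g rule: rev_induct)
    case Nil
    then show ?case by simp
  next
    case (snoc i js)
    show ?case
    proof
      fix x assume x: "x \<in> \<Omega>"
      have "foldr partial_deriv (js @ [i]) (\<lambda>x. a * f x + b * g x) x =
          foldr partial_deriv js (\<lambda>x. a * partial_deriv i f x + b * partial_deriv i g x) x"
        unfolding foldr_append
        by (rule foldr_partial_deriv_cong[OF assms(1) _ x])
          (use snoc.prems in \<open>simp add: partial_deriv_lincomb\<close>)
      then show "foldr partial_deriv (js @ [i]) (\<lambda>x. a * f x + b * g x) x =
          a * foldr partial_deriv (js @ [i]) f x + b * foldr partial_deriv (js @ [i]) g x"
        using snoc.IH[of "partial_deriv i f" "partial_deriv i g"] snoc.prems x by simp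
    qed
  qed
  then show ?thesis
    unfolding js(2)
    using cont_diff_on_mono[OF assms(2)] cont_diff_on_mono[OF assms(3)] assms(4,5) js(1) by simp
qed

lemma is_cl_extension_unique:
  assumes "is_cl_extension \<Omega> f g" "is_cl_extension \<Omega> f h" "x \<in> closure \<Omega>"
  shows "g x = h x"
proof -
  have "continuous_on (closure \<Omega>) (\<lambda>x. g x - h x)"
    using assms by (auto simp: is_cl_extension_def intro!: continuous_intros)
  moreover have "\<And>x. x \<in> \<Omega> \<Longrightarrow> g x - h x = 0"
    using assms by (auto simp: is_cl_extension_def)
  ultimately have "g x - h x = 0"
    using continuous_constant_on_closure assms(3) by blast
  then show ?thesis by simp
qed

lemma cl_D_extension:
  assumes "f \<in> C_space m \<Omega>" "multi_order \<eta> \<le> m"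
  shows "is_cl_extension \<Omega> (partial_D \<eta> f) (cl_D \<Omega> \<eta> f)"
proof -
  have "\<exists>g. is_cl_extension \<Omega> (partial_D \<eta> f) g"
    using assms by (simp add: C_space_def)
  then show ?thesis
    unfolding cl_D_def by (rule someI_ex)
qed

lemma C_space_lincomb:
  fixes \<Omega> :: "(real ^ 'n::finite) set" and a b :: real
  assumes "open \<Omega>" "f \<in> C_space m \<Omega>" "g \<in> C_space m \<Omega>"
  defines "h \<equiv> (\<lambda>x\<in>closure \<Omega>. a * f x + b * g x)"
  shows "h \<in> C_space m \<Omega>"
    and "\<And>\<eta> x. multi_order \<eta> \<le> m \<Longrightarrow> x \<in> closure \<Omega> \<Longrightarrow>
      cl_D \<Omega> \<eta> h x = a * cl_D \<Omega> \<eta> f x + b * cl_D \<Omega> \<eta> g x"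
proof -
  have h: "h x = a * f x + b * g x" if "x \<in> closure \<Omega>" for x
    using that by (simp add: h_def)
  have h': "h x = a * f x + b * g x" if "x \<in> \<Omega>" for x
    using that h closure_subset by blast
  have ext: "is_cl_extension \<Omega> (partial_D \<eta> h) (\<lambda>x. a * cl_D \<Omega> \<eta> f x + b * cl_D \<Omega> \<eta> g x)"
    if "multi_order \<eta> \<le> m" for \<eta>
  proof -
    have "partial_D \<eta> h x = a * partial_D \<eta> f x + b * partial_D \<eta> g x" if "x \<in> \<Omega>" for x
      using partial_D_cong[OF assms(1) h' that]
        partial_D_lincomb[OF assms(1) _ _ \<open>multi_order \<eta> \<le> m\<close> that] assms(2,3)
      by (simp add: C_space_def)
    then show ?thesis
      using cl_D_extension[OF assms(2) that] cl_D_extension[OF assms(3) that]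
      by (auto simp: is_cl_extension_def intro!: continuous_intros)
  qed
  have "continuous_on (closure \<Omega>) h"
    using assms(2,3) by (auto simp: C_space_def h cong: continuous_on_cong intro!: continuous_intros)
  moreover have "cont_diff_on m \<Omega> h"
    using cont_diff_on_lincomb[OF assms(1), of m f g] cont_diff_on_cong[OF assms(1) h'] assms(2,3)
    by (auto simp: C_space_def)
  ultimately show hC: "h \<in> C_space m \<Omega>"
    using ext by (auto simp: C_space_def h_def)
  show "cl_D \<Omega> \<eta> h x = a * cl_D \<Omega> \<eta> f x + b * cl_D \<Omega> \<eta> g x"
    if "multi_order \<eta> \<le> m" "x \<in> closure \<Omega>" for \<eta> x
    using is_cl_extension_unique[OF cl_D_extension[OF hC that(1)] ext[OF that(1)] that(2)] .
qed

lemma finite_multi_order_le: "finite {\<eta> :: 'n::finite \<Rightarrow> nat. multi_order \<eta> \<le> m}"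
proof (rule finite_subset)
  show "{\<eta> :: 'n \<Rightarrow> nat. multi_order \<eta> \<le> m} \<subseteq> PiE UNIV (\<lambda>_. {..m})"
  proof (intro subsetI PiE_I)
    fix \<eta> :: "'n \<Rightarrow> nat" and i
    assume "\<eta> \<in> {\<eta>. multi_order \<eta> \<le> m}"
    moreover have "\<eta> i \<le> multi_order \<eta>"
      unfolding multi_order_def by (rule member_le_sum) auto
    ultimately show "\<eta> i \<in> {..m}" by simp
  qed auto
qed (auto intro: finite_PiE)

lemma finite_multi_order: "finite {\<eta> :: 'n::finite \<Rightarrow> nat. multi_order \<eta> = m}"
  by (rule finite_subset[OF _ finite_multi_order_le[of m]]) auto

lemma sup_norm_lincomb_le:
  assumes "\<And>x. x \<in> A \<Longrightarrow> h x = a * f x + b * g x"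
  shows "(SUP x\<in>A. ennreal \<bar>h x\<bar>) \<le>
    ennreal \<bar>a\<bar> * (SUP x\<in>A. ennreal \<bar>f x\<bar>) + ennreal \<bar>b\<bar> * (SUP x\<in>A. ennreal \<bar>g x\<bar>)"
proof (rule SUP_least)
  fix x assume x: "x \<in> A"
  have "ennreal \<bar>h x\<bar> \<le> ennreal (\<bar>a\<bar> * \<bar>f x\<bar> + \<bar>b\<bar> * \<bar>g x\<bar>)"
    using assms[OF x] abs_triangle_ineq[of "a * f x" "b * g x"] by (intro ennreal_leI) (simp add: abs_mult)
  also have "\<dots> = ennreal \<bar>a\<bar> * ennreal \<bar>f x\<bar> + ennreal \<bar>b\<bar> * ennreal \<bar>g x\<bar>"
    by (simp add: ennreal_mult)
  also have "\<dots> \<le> ennreal \<bar>a\<bar> * (SUP x\<in>A. ennreal \<bar>f x\<bar>) + ennreal \<bar>b\<bar> * (SUP x\<in>A. ennreal \<bar>g x\<bar>)"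
    by (intro add_mono mult_left_mono SUP_upper x) auto
  finally show "ennreal \<bar>h x\<bar> \<le> \<dots>" .
qed

lemma hoelder_quotient_lincomb_le:
  assumes "\<And>x. x \<in> A \<Longrightarrow> h x = a * f x + b * g x"
  shows "hoelder_quotient \<alpha> A h \<le>
    ennreal \<bar>a\<bar> * hoelder_quotient \<alpha> A f + ennreal \<bar>b\<bar> * hoelder_quotient \<alpha> A g"
proof -
  let ?q = "\<lambda>f p. (f (fst p) - f (snd p)) / norm (fst p - snd p) powr \<alpha>"
  have q: "hoelder_quotient \<alpha> A f = (SUP p\<in>{(x, y). x \<in> A \<and> y \<in> A \<and> x \<noteq> y}. ennreal \<bar>?q f p\<bar>)" for f
    unfolding hoelder_quotient_def by (intro SUP_cong) auto
  show ?thesis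
    unfolding q
  proof (rule sup_norm_lincomb_le)
    fix p assume "p \<in> {(x, y). x \<in> A \<and> y \<in> A \<and> x \<noteq> y}"
    then have "fst p \<in> A" "snd p \<in> A" by auto
    then show "?q h p = a * ?q f p + b * ?q g p"
      by (simp add: assms diff_divide_distrib add_divide_distrib right_diff_distrib)
  qed
qed

lemma schauder_norm_lincomb_le:
  assumes "open \<Omega>" "f \<in> C_space m \<Omega>" "g \<in> C_space m \<Omega>"
  shows "schauder_norm m \<alpha> \<Omega> (\<lambda>x\<in>closure \<Omega>. a * f x + b * g x) \<le>
    ennreal \<bar>a\<bar> * schauder_norm m \<alpha> \<Omega> f + ennreal \<bar>b\<bar> * schauder_norm m \<alpha> \<Omega> g"
proof -
  let ?h = "\<lambda>x\<in>closure \<Omega>. a * f x + b * g x"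
  note D = C_space_lincomb(2)[OF assms]
  have "C_norm m \<Omega> ?h \<le> ennreal \<bar>a\<bar> * C_norm m \<Omega> f + ennreal \<bar>b\<bar> * C_norm m \<Omega> g"
    unfolding C_norm_def sum_distrib_left sum.distrib[symmetric]
    by (intro sum_mono sup_norm_lincomb_le D) auto
  moreover have "(\<Sum>\<eta> | multi_order \<eta> = m. hoelder_quotient \<alpha> (closure \<Omega>) (cl_D \<Omega> \<eta> ?h)) \<le>
      ennreal \<bar>a\<bar> * (\<Sum>\<eta> | multi_order \<eta> = m. hoelder_quotient \<alpha> (closure \<Omega>) (cl_D \<Omega> \<eta> f)) +
      ennreal \<bar>b\<bar> * (\<Sum>\<eta> | multi_order \<eta> = m. hoelder_quotient \<alpha> (closure \<Omega>) (cl_D \<Omega> \<eta> g))"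
    unfolding sum_distrib_left sum.distrib[symmetric]
    by (intro sum_mono hoelder_quotient_lincomb_le D) auto
  ultimately have "schauder_norm m \<alpha> \<Omega> ?h \<le>
      (ennreal \<bar>a\<bar> * C_norm m \<Omega> f + ennreal \<bar>b\<bar> * C_norm m \<Omega> g) +
      (ennreal \<bar>a\<bar> * (\<Sum>\<eta> | multi_order \<eta> = m. hoelder_quotient \<alpha> (closure \<Omega>) (cl_D \<Omega> \<eta> f)) +
       ennreal \<bar>b\<bar> * (\<Sum>\<eta> | multi_order \<eta> = m. hoelder_quotient \<alpha> (closure \<Omega>) (cl_D \<Omega> \<eta> g)))"
    unfolding schauder_norm_def by (rule add_mono)
  also have "\<dots> = ennreal \<bar>a\<bar> * schauder_norm m \<alpha> \<Omega> f + ennreal \<bar>b\<bar> * schauder_norm m \<alpha> \<Omega> g"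
    unfolding schauder_norm_def distrib_left by (simp only: ac_simps)
  finally show ?thesis .
qed

lemma schauder_norm_finite:
  assumes "bounded \<Omega>" "f \<in> schauder_space m \<alpha> \<Omega>"
  shows "schauder_norm m \<alpha> \<Omega> f < \<infinity>"
proof -
  have f: "f \<in> C_space m \<Omega>" using assms by (simp add: schauder_space_def)
  have "(SUP x\<in>closure \<Omega>. ennreal \<bar>cl_D \<Omega> \<eta> f x\<bar>) < \<infinity>" if "multi_order \<eta> \<le> m" for \<eta>
  proof -
    have "compact (cl_D \<Omega> \<eta> f ` closure \<Omega>)"
      using cl_D_extension[OF f that] assms(1)
      by (auto simp: is_cl_extension_def intro!: compact_continuous_image)
    then obtain B where B: "\<And>x. x \<in> closure \<Omega> \<Longrightarrow> \<bar>cl_D \<Omega> \<eta> f x\<bar> \<le> B"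
      using compact_imp_bounded bounded_iff by (metis imageI real_norm_def)
    have "(SUP x\<in>closure \<Omega>. ennreal \<bar>cl_D \<Omega> \<eta> f x\<bar>) \<le> ennreal B"
      by (intro SUP_least ennreal_leI B)
    then show ?thesis using ennreal_less_top le_less_trans by fastforce
  qed
  then show ?thesis
    using assms(2) unfolding schauder_norm_def C_norm_def schauder_space_def
    by (auto simp: finite_multi_order finite_multi_order_le infinity_ennreal_def)
qed

lemma schauder_space_diff:
  assumes "open \<Omega>" "f \<in> schauder_space m \<alpha> \<Omega>" "g \<in> schauder_space m \<alpha> \<Omega>"
  shows "(\<lambda>x\<in>closure \<Omega>. f x - g x) \<in> schauder_space m \<alpha> \<Omega>"
proof -
  have fg: "f \<in> C_space m \<Omega>" "g \<in> C_space m \<Omega>" using assms by (auto simp: schauder_space_def)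
  let ?h = "\<lambda>x\<in>closure \<Omega>. f x - g x"
  have h: "?h = (\<lambda>x\<in>closure \<Omega>. 1 * f x + (-1) * g x)" by auto
  have "hoelder_quotient \<alpha> (closure \<Omega>) (cl_D \<Omega> \<eta> ?h) < \<infinity>" if "multi_order \<eta> = m" for \<eta>
  proof -
    have "hoelder_quotient \<alpha> (closure \<Omega>) (cl_D \<Omega> \<eta> ?h) \<le>
        ennreal \<bar>1\<bar> * hoelder_quotient \<alpha> (closure \<Omega>) (cl_D \<Omega> \<eta> f) +
        ennreal \<bar>-1\<bar> * hoelder_quotient \<alpha> (closure \<Omega>) (cl_D \<Omega> \<eta> g)"
      unfolding h by (intro hoelder_quotient_lincomb_le C_space_lincomb(2)[OF assms(1) fg]) (use that in auto)
    also have "\<dots> < \<infinity>"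
      using assms(2,3) that by (simp add: schauder_space_def)
    finally show ?thesis .
  qed
  then show ?thesis
    using C_space_lincomb(1)[OF assms(1) fg, of 1 "-1", folded h] by (simp add: schauder_space_def)
qed

lemma partial_D_0: "partial_D (\<lambda>_. 0) f = f"
proof -
  have "foldr (\<lambda>i. partial_deriv i ^^ 0) js f = f" for js
    by (induction js) auto
  then show ?thesis by (simp add: partial_D_def)
qed

lemma cl_D_0:
  assumes "f \<in> C_space m \<Omega>" "x \<in> closure \<Omega>"
  shows "cl_D \<Omega> (\<lambda>_. 0) f x = f x"
proof (rule is_cl_extension_unique[OF cl_D_extension[OF assms(1)] _ assms(2)])
  show "is_cl_extension \<Omega> (partial_D (\<lambda>_. 0) f) f"
    using assms(1) by (simp add: partial_D_0 is_cl_extension_def C_space_def)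
qed (simp add: multi_order_def)

lemma abs_le_schauder_norm:
  assumes "f \<in> C_space m \<Omega>" "x \<in> closure \<Omega>"
  shows "ennreal \<bar>f x\<bar> \<le> schauder_norm m \<alpha> \<Omega> f"
proof -
  have "ennreal \<bar>f x\<bar> \<le> (SUP x\<in>closure \<Omega>. ennreal \<bar>cl_D \<Omega> (\<lambda>_. 0) f x\<bar>)"
    using assms(2) by (intro SUP_upper2[of x]) (auto simp: cl_D_0[OF assms])
  also have "\<dots> \<le> C_norm m \<Omega> f"
    unfolding C_norm_def
    by (rule member_le_sum[where f = "\<lambda>\<eta>. SUP x\<in>closure \<Omega>. ennreal \<bar>cl_D \<Omega> \<eta> f x\<bar>"])
      (simp_all add: finite_multi_order_le, simp add: multi_order_def)
  finally show ?thesis by (simp add: schauder_norm_def add_increasing2)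
qed

lemma schauder_metric:
  assumes "open \<Omega>" "bounded \<Omega>"
  shows "Metric_space (schauder_space m \<alpha> \<Omega>) (schauder_dist m \<alpha> \<Omega>)"
proof
  let ?M = "schauder_space m \<alpha> \<Omega>" and ?d = "schauder_dist m \<alpha> \<Omega>" and ?N = "schauder_norm m \<alpha> \<Omega>"
  have C: "f \<in> C_space m \<Omega>" if "f \<in> ?M" for f using that by (simp add: schauder_space_def)
  note fin = schauder_norm_finite[OF assms(2) schauder_space_diff[OF assms(1)]]
  show "0 \<le> ?d f g" for f g by (simp add: schauder_dist_def)
  have le: "?N (\<lambda>x\<in>closure \<Omega>. g x - f x) \<le> ?N (\<lambda>x\<in>closure \<Omega>. f x - g x)" if "f \<in> ?M" "g \<in> ?M" for f g
  proof -
    let ?k = "\<lambda>x\<in>closure \<Omega>. f x - g x"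
    have "?k \<in> C_space m \<Omega>" using schauder_space_diff[OF assms(1) that] C by blast
    from schauder_norm_lincomb_le[OF assms(1) this this, of \<alpha> "-1" 0]
    show ?thesis by (simp cong: restrict_cong)
  qed
  show "?d f g = ?d g f" for f g
    using le[of f g] le[of g f] by (auto simp: schauder_dist_def)
  show "?d f g = 0 \<longleftrightarrow> f = g" if "f \<in> ?M" "g \<in> ?M" for f g
  proof
    let ?k = "\<lambda>x\<in>closure \<Omega>. f x - g x"
    have k: "?k \<in> C_space m \<Omega>" using schauder_space_diff[OF assms(1) that] C by blast
    assume "?d f g = 0"
    then have "?N ?k = 0"
      using fin[OF that] that by (auto simp: schauder_dist_def enn2real_eq_0_iff)
    then have "f x = g x" if "x \<in> closure \<Omega>" for x
      using abs_le_schauder_norm[OF k that, of \<alpha>] that by (simp add: ennreal_eq_0_iff)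
    moreover have "f \<in> extensional (closure \<Omega>)" "g \<in> extensional (closure \<Omega>)"
      using C[OF that(1)] C[OF that(2)] by (auto simp: C_space_def)
    ultimately show "f = g" by (rule extensionalityI[rotated 2])
  next
    assume "f = g"
    moreover have "?N (\<lambda>x\<in>closure \<Omega>. 0 * f x + 0 * f x) \<le> 0"
      using schauder_norm_lincomb_le[OF assms(1) C[OF that(1)] C[OF that(1)], of \<alpha> 0 0] by simp
    ultimately show "?d f g = 0" by (simp add: schauder_dist_def)
  qed
  show "?d f h \<le> ?d f g + ?d g h" if M: "f \<in> ?M" "g \<in> ?M" "h \<in> ?M" for f g h
  proof -
    let ?u = "\<lambda>x\<in>closure \<Omega>. f x - g x" and ?v = "\<lambda>x\<in>closure \<Omega>. g x - h x"
    have "?u \<in> C_space m \<Omega>" "?v \<in> C_space m \<Omega>"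
      using schauder_space_diff[OF assms(1)] C M by blast+
    from schauder_norm_lincomb_le[OF assms(1) this, of \<alpha> 1 1]
    have "?N (\<lambda>x\<in>closure \<Omega>. f x - h x) \<le> ?N ?u + ?N ?v"
      by (simp cong: restrict_cong)
    then show ?thesis
      using fin[OF M(1,2)] fin[OF M(2,3)] M
      by (auto simp: schauder_dist_def enn2real_plus[symmetric] infinity_ennreal_def intro!: enn2real_mono)
  qed
qed

end

theory Submission
  imports Defs
begin

text \<open>Relative compactness means total boundedness, because the Schauder space is complete: derivatives
  of a Cauchy sequence converge uniformly, and a uniform limit of \<open>C\<^sup>1\<close> functions with uniformly
  convergent gradients is \<open>C\<^sup>1\<close>.

  If \<open>K\<close> is totally bounded, take a finite net of \<open>K\<close>. The difference quotients of its finitely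
  many members are bounded and continuous off the diagonal, so a common finite open cover makes their
  oscillations small, and quotients of the other members of \<open>K\<close> are uniformly close to these.

  Conversely, boundedness makes all derivatives up to order \<open>m\<close> equicontinuous: those of order \<open>m\<close> by the
  Hoelder bound, those of lower order because a bounded gradient on a domain with finite geodesic
  constant gives a Lipschitz bound (integrate along an arc). Hence the values of the derivatives on a
  finite net of the domain, and of the difference quotients at one point of each set of the covering,
  determine a member of \<open>K\<close> up to a small error, and these finitely many values are bounded. The
  Lipschitz step and the completeness need mixed partial derivatives to commute, since \<^const>\<open>partial_D\<close>
  takes them in a fixed order.\<close>

section \<open>Symmetry of higher partial derivatives\<close>

text \<open>A linear map is determined by its values on the axis vectors, and the chain rule along
  an axis identifies these with the partial derivatives. This gradient form serves the chain rule
  along arcs and the convergence of derivatives.\<close>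

lemma has_derivative_partial_derivs:
  assumes "f differentiable (at x)"
  shows "(f has_derivative (\<lambda>v. \<Sum>i\<in>UNIV. v $ i * partial_deriv i f x)) (at x)"
proof -
  obtain f' where f': "(f has_derivative f') (at x)"
    using assms by (auto simp: differentiable_def)
  interpret f': bounded_linear f' using f' by (rule has_derivative_bounded_linear)
  have p: "partial_deriv i f x = f' (axis i 1)" for i
  proof -
    have "((\<lambda>t. x + t *\<^sub>R axis i 1) has_derivative (\<lambda>t. t *\<^sub>R axis i 1)) (at (0::real))"
      by (auto intro!: derivative_eq_intros)
    then have "((\<lambda>t. f (x + t *\<^sub>R axis i 1)) has_derivative (\<lambda>t. f' (t *\<^sub>R axis i 1))) (at (0::real))"
      using f' has_derivative_compose[of "\<lambda>t. x + t *\<^sub>R axis i 1" _ 0 UNIV f f'] by simp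
    then have "((\<lambda>t. f (x + t *\<^sub>R axis i 1)) has_field_derivative f' (axis i 1)) (at 0)"
      by (simp add: has_field_derivative_def f'.scaleR mult.commute[of _ "f' (axis i 1)"])
    then show ?thesis
      using DERIV_unique[OF partial_deriv_line[OF assms]] by blast
  qed
  have "f' v = (\<Sum>i\<in>UNIV. v $ i * partial_deriv i f x)" for v
  proof -
    have "f' v = f' (\<Sum>i\<in>UNIV. v $ i *\<^sub>R axis i 1)"
      using basis_expansion[of v] by (simp add: scalar_mult_eq_scaleR)
    also have "\<dots> = (\<Sum>i\<in>UNIV. v $ i * partial_deriv i f x)"
      by (simp add: f'.sum f'.scaleR p)
    finally show ?thesis .
  qed
  then show ?thesis using f' by presburger
qed

lemma DERIV_along_axis:
  assumes "f differentiable (at (x + t *\<^sub>R axis i 1))"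
  shows "((\<lambda>t. f (x + t *\<^sub>R axis i 1)) has_field_derivative
    partial_deriv i f (x + t *\<^sub>R axis i 1)) (at t)"
  using partial_deriv_line[OF assms, of i] DERIV_shift[of "\<lambda>t. f (x + t *\<^sub>R axis i 1)" _ 0 t]
  by (simp add: algebra_simps)

text \<open>Two applications of the mean value theorem to the second difference of \<open>f\<close> over a
  parallelogram; exchanging \<open>i\<close> and \<open>j\<close> leaves the second difference unchanged.\<close>

lemma second_difference_mean_value:
  fixes f :: "real ^ 'n::finite \<Rightarrow> real"
  assumes "0 < h"
    and d1: "\<And>s t. 0 \<le> s \<Longrightarrow> s \<le> h \<Longrightarrow> 0 \<le> t \<Longrightarrow> t \<le> h \<Longrightarrow>
      f differentiable (at (x + s *\<^sub>R axis i 1 + t *\<^sub>R axis j 1))"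
    and d2: "\<And>s t. 0 \<le> s \<Longrightarrow> s \<le> h \<Longrightarrow> 0 \<le> t \<Longrightarrow> t \<le> h \<Longrightarrow>
      partial_deriv i f differentiable (at (x + s *\<^sub>R axis i 1 + t *\<^sub>R axis j 1))"
  obtains s t where "0 \<le> s" "s \<le> h" "0 \<le> t" "t \<le> h"
    "f (x + h *\<^sub>R axis i 1 + h *\<^sub>R axis j 1) - f (x + h *\<^sub>R axis i 1) - f (x + h *\<^sub>R axis j 1) + f x =
     h * h * partial_deriv j (partial_deriv i f) (x + s *\<^sub>R axis i 1 + t *\<^sub>R axis j 1)"
proof -
  let ?a = "axis i 1 :: real ^ 'n" and ?b = "axis j 1 :: real ^ 'n"
  \<comment> \<open>\<open>?g\<close> is a first difference in direction \<open>j\<close>, so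
    \<open>?g h - ?g 0\<close> is the second difference. The derivative of \<open>?g\<close> is
    again a difference in direction \<open>j\<close>, now of \<open>partial_deriv i f\<close>;
    \<open>?k\<close> treats it the same way.\<close>
  let ?g = "\<lambda>s. f ((x + h *\<^sub>R ?b) + s *\<^sub>R ?a) - f (x + s *\<^sub>R ?a)"
  have "\<exists>s>0. s < h \<and> ?g h - ?g 0 = (h - 0) *
    (partial_deriv i f ((x + h *\<^sub>R ?b) + s *\<^sub>R ?a) - partial_deriv i f (x + s *\<^sub>R ?a))"
  proof (rule MVT2[OF assms(1)])
    fix s assume s: "0 \<le> s" "s \<le> h"
    show "(?g has_field_derivative
      partial_deriv i f ((x + h *\<^sub>R ?b) + s *\<^sub>R ?a) - partial_deriv i f (x + s *\<^sub>R ?a)) (at s)"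
      using d1[OF s, of h] d1[OF s, of 0] assms(1)
      by (intro DERIV_diff DERIV_along_axis) (simp_all add: add_ac)
  qed
  then obtain s where s: "0 < s" "s < h" "?g h - ?g 0 = h *
    (partial_deriv i f ((x + s *\<^sub>R ?a) + h *\<^sub>R ?b) - partial_deriv i f (x + s *\<^sub>R ?a))"
    by (auto simp: add_ac)
  let ?k = "\<lambda>t. partial_deriv i f ((x + s *\<^sub>R ?a) + t *\<^sub>R ?b)"
  have "\<exists>t>0. t < h \<and> ?k h - ?k 0 = (h - 0) *
    partial_deriv j (partial_deriv i f) ((x + s *\<^sub>R ?a) + t *\<^sub>R ?b)"
    using d2 s by (intro MVT2[OF assms(1)] DERIV_along_axis) simp
  then obtain t where t: "0 < t" "t < h" "?k h - ?k 0 = h *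
    partial_deriv j (partial_deriv i f) ((x + s *\<^sub>R ?a) + t *\<^sub>R ?b)"
    by auto
  show thesis
    by (rule that[of s t]) (use s t in \<open>simp_all add: algebra_simps\<close>)
qed

text \<open>Schwarz's theorem. One and the same second difference equals \<open>h * h\<close> times
  either mixed derivative, each taken at some point of a small parallelogram; by continuity both
  values are close to those at \<open>x\<close>.\<close>

lemma partial_deriv_commute:
  fixes f :: "real ^ 'n::finite \<Rightarrow> real"
  assumes "open \<Omega>" "cont_diff_on (Suc (Suc 0)) \<Omega> f" "x \<in> \<Omega>"
  shows "partial_deriv i (partial_deriv j f) x = partial_deriv j (partial_deriv i f) x"
proof (rule ccontr)
  let ?A = "partial_deriv i (partial_deriv j f)" and ?B = "partial_deriv j (partial_deriv i f)"
  assume ne: "?A x \<noteq> ?B x"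
  \<comment> \<open>Half the supposed gap: two errors below \<open>e\<close> cannot add up to
    it.\<close>
  define e where "e = \<bar>?A x - ?B x\<bar> / 2"
  have e: "e > 0" using ne by (simp add: e_def)
  have c: "continuous_on \<Omega> ?A" "continuous_on \<Omega> ?B" using assms(2) by auto
  obtain d1 where d1: "d1 > 0" "\<And>y. y \<in> \<Omega> \<Longrightarrow> dist y x < d1 \<Longrightarrow> dist (?A y) (?A x) < e"
    using c(1) e assms(3) unfolding continuous_on_iff by meson
  obtain d2 where d2: "d2 > 0" "\<And>y. y \<in> \<Omega> \<Longrightarrow> dist y x < d2 \<Longrightarrow> dist (?B y) (?B x) < e"
    using c(2) e assms(3) unfolding continuous_on_iff by meson
  obtain d3 where d3: "d3 > 0" "ball x d3 \<subseteq> \<Omega>"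
    using assms(1,3) by (meson openE)
  \<comment> \<open>Points of the parallelogram are at distance at most \<open>2 * h\<close> from
    \<open>x\<close>, hence strictly within \<open>3 * h\<close>, which is at most each of the three
    radii.\<close>
  define h where "h = Min {d1, d2, d3} / 3"
  have h: "h > 0" "3 * h \<le> d1" "3 * h \<le> d2" "3 * h \<le> d3"
    using d1 d2 d3 by (auto simp: h_def)
  have near: "dist (x + s *\<^sub>R axis k 1 + t *\<^sub>R axis l 1) x < 3 * h"
    if "0 \<le> s" "s \<le> h" "0 \<le> t" "t \<le> h" for s t and k l :: 'n
  proof -
    have "norm (s *\<^sub>R axis k 1 + t *\<^sub>R axis l 1 :: real ^ 'n) \<le> \<bar>s\<bar> * 1 + \<bar>t\<bar> * 1"
      by (rule order_trans[OF norm_triangle_ineq]) (simp add: norm_axis_1)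
    then show ?thesis using that h(1) by (simp add: dist_norm add.assoc)
  qed
  have mem: "x + s *\<^sub>R axis k 1 + t *\<^sub>R axis l 1 \<in> \<Omega>"
    if "0 \<le> s" "s \<le> h" "0 \<le> t" "t \<le> h" for s t and k l :: 'n
    using near[OF that, of k l] d3(2) h(4) by (auto simp: dist_commute)
  have df: "f differentiable (at y)" "partial_deriv k f differentiable (at y)" if "y \<in> \<Omega>" for y k
    using assms(2) that by auto
  obtain s t where st: "0 \<le> s" "s \<le> h" "0 \<le> t" "t \<le> h"
    "f (x + h *\<^sub>R axis i 1 + h *\<^sub>R axis j 1) - f (x + h *\<^sub>R axis i 1) - f (x + h *\<^sub>R axis j 1) + f x =
     h * h * ?B (x + s *\<^sub>R axis i 1 + t *\<^sub>R axis j 1)"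
    by (rule second_difference_mean_value[OF h(1), of f x i j]) (use df mem in auto)
  obtain s' t' where st': "0 \<le> s'" "s' \<le> h" "0 \<le> t'" "t' \<le> h"
    "f (x + h *\<^sub>R axis j 1 + h *\<^sub>R axis i 1) - f (x + h *\<^sub>R axis j 1) - f (x + h *\<^sub>R axis i 1) + f x =
     h * h * ?A (x + s' *\<^sub>R axis j 1 + t' *\<^sub>R axis i 1)"
    by (rule second_difference_mean_value[OF h(1), of f x j i]) (use df mem in auto)
  \<comment> \<open>Both sides are the same second difference, written with the increments in
    opposite orders.\<close>
  have "h * h * ?A (x + s' *\<^sub>R axis j 1 + t' *\<^sub>R axis i 1) = h * h * ?B (x + s *\<^sub>R axis i 1 + t *\<^sub>R axis j 1)"
    using st(5) st'(5) add.commute[of "h *\<^sub>R axis i 1" "h *\<^sub>R axis j 1"]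
    unfolding add.assoc[of x] by (smt (verit))
  then have eq: "?A (x + s' *\<^sub>R axis j 1 + t' *\<^sub>R axis i 1) = ?B (x + s *\<^sub>R axis i 1 + t *\<^sub>R axis j 1)"
    using h(1) by simp
  have "dist (?B (x + s *\<^sub>R axis i 1 + t *\<^sub>R axis j 1)) (?B x) < e"
    using near[OF st(1-4), of i j] h(3) mem[OF st(1-4)] by (intro d2(2)) auto
  moreover have "dist (?A (x + s' *\<^sub>R axis j 1 + t' *\<^sub>R axis i 1)) (?A x) < e"
    using near[OF st'(1-4), of j i] h(2) mem[OF st'(1-4)] by (intro d1(2)) auto
  ultimately have "\<bar>?A x - ?B x\<bar> < 2 * e"
    unfolding eq dist_real_def by linarith
  then show False by (simp add: e_def)
qed

section \<open>Independence of the order of differentiation\<close>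

lemma cont_diff_on_foldr_partial_deriv:
  assumes "cont_diff_on (length js + k) \<Omega> f"
  shows "cont_diff_on k \<Omega> (foldr partial_deriv js f)"
  \<comment> \<open>\<open>foldr\<close> applies the last entry of the list first, and
    \<open>cont_diff_on\<close> also unfolds at the innermost derivative; hence the induction from
    the end of the list.\<close>
  using assms by (induction js arbitrary: f rule: rev_induct) auto

text \<open>Carries the outermost derivative inwards one place at a time. Each exchange is Schwarz's
  theorem for the derivative by the rest of the list, which is still twice continuously
  differentiable.\<close>

lemma foldr_partial_deriv_shift:
  assumes "open \<Omega>" "cont_diff_on (Suc (length js)) \<Omega> f" "x \<in> \<Omega>"
  shows "foldr partial_deriv (i # js) f x = foldr partial_deriv (js @ [i]) f x"
  using assms(2,3)
proof (induction js arbitrary: x)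
  case Nil
  then show ?case by simp
next
  case (Cons j js)
  let ?g = "foldr partial_deriv js f"
  have g: "cont_diff_on (Suc (Suc 0)) \<Omega> ?g"
    by (rule cont_diff_on_foldr_partial_deriv) (use Cons.prems in simp)
  have f: "cont_diff_on (Suc (length js)) \<Omega> f"
    by (rule cont_diff_on_mono[OF Cons.prems(1)]) simp
  have "foldr partial_deriv (i # j # js) f x = partial_deriv j (partial_deriv i ?g) x"
    using partial_deriv_commute[OF assms(1) g Cons.prems(2)] by simp
  also have "\<dots> = partial_deriv j (foldr partial_deriv (js @ [i]) f) x"
    using Cons.IH[OF f] by (intro partial_deriv_cong[OF assms(1) Cons.prems(2)]) simp
  finally show ?case by simp
qed

text \<open>In both lists the entry \<open>i\<close> is moved to the innermost place. What remains
  are two rearrangements of a shorter list, applied to \<open>partial_deriv i f\<close>; the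
  induction therefore varies the function.\<close>

lemma foldr_partial_deriv_mset:
  assumes "open \<Omega>" "cont_diff_on (length js) \<Omega> f" "mset js = mset ks" "x \<in> \<Omega>"
  shows "foldr partial_deriv js f x = foldr partial_deriv ks f x"
  using assms(2-4)
proof (induction js arbitrary: ks f x)
  case Nil
  then show ?case by simp
next
  case (Cons i js)
  have "i \<in> set ks" using Cons.prems(2) by (metis list.set_intros(1) set_mset_mset)
  then obtain as bs where ks: "ks = as @ i # bs" by (auto simp: in_set_conv_decomp)
  have ms: "mset js = mset (as @ bs)" using Cons.prems(2) ks by simp
  then have len: "length js = length as + length bs"
    by (metis length_append size_mset)
  have *: "foldr partial_deriv (i # bs) f y = foldr partial_deriv (bs @ [i]) f y" if "y \<in> \<Omega>" for y
    by (rule foldr_partial_deriv_shift[OF assms(1) _ that])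
      (rule cont_diff_on_mono[OF Cons.prems(1)], simp add: len)
  have "foldr partial_deriv (i # js) f x = foldr partial_deriv js (partial_deriv i f) x"
    using foldr_partial_deriv_shift[OF assms(1) _ Cons.prems(3), of js f i] Cons.prems(1) by simp
  also have "\<dots> = foldr partial_deriv (as @ bs) (partial_deriv i f) x"
    using Cons.prems(1) by (intro Cons.IH ms Cons.prems(3)) simp
  also have "\<dots> = foldr partial_deriv as (foldr partial_deriv (bs @ [i]) f) x"
    by simp
  also have "\<dots> = foldr partial_deriv ks f x"
    unfolding ks foldr_append[of _ as]
    by (rule foldr_partial_deriv_cong[OF assms(1) _ Cons.prems(3)]) (use * in simp)
  finally show ?case .
qed

section \<open>Multi-indices as counts of coordinate lists\<close>

lemma multi_order_count: "multi_order (count (mset js)) = length js"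
proof -
  have "(\<Sum>i\<in>UNIV. count (mset js) i) = size (mset js)"
    unfolding size_multiset_overloaded_eq by (rule sum.mono_neutral_right) (auto simp: not_in_iff)
  then show ?thesis by (simp add: multi_order_def)
qed

text \<open>\<open>partial_D\<close> differentiates along \<open>ks\<close>, which lists the
  coordinates in blocks; \<open>js\<close> is a rearrangement of it. With arbitrary lists available,
  one more partial derivative of a \<open>partial_D\<close> is simply a longer list
  \<open>i # js\<close>.\<close>

lemma partial_D_eq_foldr:
  fixes f :: "real ^ 'n::finite \<Rightarrow> real"
  assumes "open \<Omega>" "cont_diff_on (length js) \<Omega> f" "x \<in> \<Omega>"
  shows "partial_D (count (mset js)) f x = foldr partial_deriv js f x"
proof -
  define \<eta> where "\<eta> = count (mset js)"
  define ks where "ks = concat (map (\<lambda>i. replicate (\<eta> i) i) (coords :: 'n list))"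
  have r: "foldr partial_deriv (replicate k i) f = (partial_deriv i ^^ k) f" for k and i :: 'n and f
    by (induction k) auto
  have "foldr partial_deriv (concat (map (\<lambda>i. replicate (\<eta> i) i) is)) f =
      foldr (\<lambda>i. partial_deriv i ^^ \<eta> i) is f" for "is" f
    by (induction "is") (auto simp: r)
  then have "partial_D \<eta> f = foldr partial_deriv ks f"
    by (simp add: partial_D_def ks_def)
  moreover have "mset ks = mset js"
  proof (rule multiset_eqI)
    fix i
    have "count (mset (concat (map (\<lambda>i. replicate (\<eta> i) i) xs))) i = (if i \<in> set xs then \<eta> i else 0)"
      if "distinct xs" for xs
      using that by (induction xs) auto
    then show "count (mset ks) i = count (mset js) i"
      using coords[where 'n = 'n] by (simp add: ks_def \<eta>_def)
  qed
  ultimately show ?thesis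
    using foldr_partial_deriv_mset[OF assms(1,2) _ assms(3), of ks] by (simp add: \<eta>_def)
qed

text \<open>The coordinate type is finite, so every multi-index has finite support and is the count
  of a multiset.\<close>

lemma multi_index_list: obtains js where "count (mset js) = (\<eta> :: 'n::finite \<Rightarrow> nat)"
proof -
  have "count (Abs_multiset \<eta>) = \<eta>"
    by (intro count_Abs_multiset) (metis finite_code)
  then show ?thesis using that ex_mset by metis
qed

section \<open>Pointwise control of the Schauder norm\<close>

lemma off_diagonal_iff [simp]: "(x, y) \<in> off_diagonal A \<longleftrightarrow> x \<in> A \<and> y \<in> A \<and> x \<noteq> y"
  by (auto simp: off_diagonal_def)

lemma abs_cl_D_le_schauder_norm:
  assumes "multi_order \<eta> \<le> m" "x \<in> closure \<Omega>"
  shows "ennreal \<bar>cl_D \<Omega> \<eta> f x\<bar> \<le> schauder_norm m \<alpha> \<Omega> f"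
proof -
  have "ennreal \<bar>cl_D \<Omega> \<eta> f x\<bar> \<le> (SUP x\<in>closure \<Omega>. ennreal \<bar>cl_D \<Omega> \<eta> f x\<bar>)"
    using assms(2) by (rule SUP_upper)
  also have "\<dots> \<le> C_norm m \<Omega> f"
    unfolding C_norm_def
    by (rule member_le_sum[where f = "\<lambda>\<eta>. SUP x\<in>closure \<Omega>. ennreal \<bar>cl_D \<Omega> \<eta> f x\<bar>"])
      (simp_all add: finite_multi_order_le assms(1))
  finally show ?thesis by (simp add: schauder_norm_def add_increasing2)
qed

lemma abs_hoelder_diff_le_schauder_norm:
  assumes "multi_order \<eta> = m" "p \<in> off_diagonal (closure \<Omega>)"
  shows "ennreal \<bar>hoelder_diff \<alpha> (cl_D \<Omega> \<eta> f) p\<bar> \<le> schauder_norm m \<alpha> \<Omega> f"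
proof -
  obtain x y where p: "p = (x, y)" by (cases p)
  have "ennreal \<bar>hoelder_diff \<alpha> (cl_D \<Omega> \<eta> f) p\<bar> \<le> hoelder_quotient \<alpha> (closure \<Omega>) (cl_D \<Omega> \<eta> f)"
    unfolding hoelder_quotient_def
    by (rule SUP_upper2[of "(x, y)"]) (use assms(2) in \<open>auto simp: p hoelder_diff_def\<close>)
  also have "\<dots> \<le> (\<Sum>\<eta> | multi_order \<eta> = m. hoelder_quotient \<alpha> (closure \<Omega>) (cl_D \<Omega> \<eta> f))"
    by (rule member_le_sum[where f = "\<lambda>\<eta>. hoelder_quotient \<alpha> (closure \<Omega>) (cl_D \<Omega> \<eta> f)"])
      (simp_all add: finite_multi_order assms(1))
  finally show ?thesis by (simp add: schauder_norm_def add_increasing)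
qed

lemma abs_le_closure:
  fixes g :: "'a::topological_space \<Rightarrow> real"
  assumes "continuous_on (closure \<Omega>) g" "\<And>x. x \<in> \<Omega> \<Longrightarrow> \<bar>g x\<bar> \<le> e" "x \<in> closure \<Omega>"
  shows "\<bar>g x\<bar> \<le> e"
  by (rule continuous_le_on_closure[OF _ assms(3), of "\<lambda>x. \<bar>g x\<bar>"])
    (use assms in \<open>auto intro!: continuous_intros\<close>)

text \<open>The quotient itself need not extend continuously to the diagonal. Clearing the
  denominator gives an inequality between functions continuous on the whole closed product; on the
  diagonal it reads \<open>0 \<le> 0\<close>, because \<open>\<alpha>\<close> is positive.\<close>

lemma hoelder_le_closure:
  fixes g :: "'a::real_normed_vector \<Rightarrow> real"
  assumes "continuous_on (closure \<Omega>) g" "0 < \<alpha>"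
    and "\<And>p. p \<in> off_diagonal \<Omega> \<Longrightarrow> \<bar>hoelder_diff \<alpha> g p\<bar> \<le> e"
    and "p \<in> off_diagonal (closure \<Omega>)"
  shows "\<bar>hoelder_diff \<alpha> g p\<bar> \<le> e"
proof -
  obtain x y where p: "p = (x, y)" and xy: "x \<in> closure \<Omega>" "y \<in> closure \<Omega>" "x \<noteq> y"
    using assms(4) by (cases p) auto
  let ?h = "\<lambda>p. \<bar>g (fst p) - g (snd p)\<bar> - e * norm (fst p - snd p) powr \<alpha>"
  have "?h (x, y) \<le> 0"
  proof (rule continuous_le_on_closure[where S = "\<Omega> \<times> \<Omega>"])
    show "continuous_on (closure (\<Omega> \<times> \<Omega>)) ?h"
      unfolding closure_Times using assms(2)
      by (intro continuous_intros continuous_on_powr' continuous_on_compose2[OF assms(1)]) auto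
    show "(x, y) \<in> closure (\<Omega> \<times> \<Omega>)" using xy by (simp add: closure_Times)
    fix q assume "q \<in> \<Omega> \<times> \<Omega>"
    then show "?h q \<le> 0"
      using assms(3)[of q] assms(2)
      by (cases "fst q = snd q") (auto simp: hoelder_diff_def abs_div divide_le_eq)
  qed
  then show ?thesis
    using xy by (simp add: p hoelder_diff_def divide_le_eq)
qed

lemma cl_D_continuous:
  "f \<in> C_space m \<Omega> \<Longrightarrow> multi_order \<eta> \<le> m \<Longrightarrow> continuous_on (closure \<Omega>) (cl_D \<Omega> \<eta> f)"
  using cl_D_extension by (auto simp: is_cl_extension_def)

lemma cl_D_eq_partial_D:
  "f \<in> C_space m \<Omega> \<Longrightarrow> multi_order \<eta> \<le> m \<Longrightarrow> x \<in> \<Omega> \<Longrightarrow> cl_D \<Omega> \<eta> f x = partial_D \<eta> f x"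
  using cl_D_extension unfolding is_cl_extension_def by blast

text \<open>The number of summands in \<open>schauder_norm\<close>, and so the price of passing from
  a common bound on all summands to the norm. The type argument carries the dimension.\<close>

definition num_evals :: "'n::finite itself \<Rightarrow> nat \<Rightarrow> nat" where
  "num_evals _ m = card {\<eta> :: 'n \<Rightarrow> nat. multi_order \<eta> \<le> m} + card {\<eta> :: 'n \<Rightarrow> nat. multi_order \<eta> = m}"

lemma hoelder_quotient_le:
  assumes "\<And>p. p \<in> off_diagonal A \<Longrightarrow> \<bar>hoelder_diff \<alpha> g p\<bar> \<le> e"
  shows "hoelder_quotient \<alpha> A g \<le> ennreal e"
  unfolding hoelder_quotient_def
proof (rule SUP_least)
  fix p assume "p \<in> {(x, y). x \<in> A \<and> y \<in> A \<and> x \<noteq> y}"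
  then show "(case p of (x, y) \<Rightarrow> ennreal (\<bar>g x - g y\<bar> / norm (x - y) powr \<alpha>)) \<le> ennreal e"
    using assms[of p] by (auto simp: hoelder_diff_def split: prod.splits intro!: ennreal_leI)
qed

text \<open>Estimates on \<open>\<Omega>\<close> suffice: continuity carries them to the closure,
  and then each of the \<open>num_evals\<close> summands is at most \<open>e\<close>.\<close>

lemma schauder_norm_le:
  fixes \<Omega> :: "(real ^ 'n::finite) set" and e :: real
  assumes "0 < \<alpha>" "0 \<le> e" "f \<in> C_space m \<Omega>"
    and D: "\<And>\<eta> x. multi_order \<eta> \<le> m \<Longrightarrow> x \<in> \<Omega> \<Longrightarrow> \<bar>cl_D \<Omega> \<eta> f x\<bar> \<le> e"
    and H: "\<And>\<eta> p. multi_order \<eta> = m \<Longrightarrow> p \<in> off_diagonal \<Omega> \<Longrightarrow> \<bar>hoelder_diff \<alpha> (cl_D \<Omega> \<eta> f) p\<bar> \<le> e"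
  shows "schauder_norm m \<alpha> \<Omega> f \<le> ennreal (num_evals TYPE('n) m * e)"
proof -
  have "C_norm m \<Omega> f \<le> (\<Sum>\<eta> :: 'n \<Rightarrow> nat | multi_order \<eta> \<le> m. ennreal e)"
    unfolding C_norm_def
    by (intro sum_mono SUP_least ennreal_leI abs_le_closure[OF cl_D_continuous[OF assms(3)] D]) auto
  moreover have "(\<Sum>\<eta> | multi_order \<eta> = m. hoelder_quotient \<alpha> (closure \<Omega>) (cl_D \<Omega> \<eta> f)) \<le>
      (\<Sum>\<eta> :: 'n \<Rightarrow> nat | multi_order \<eta> = m. ennreal e)"
    by (intro sum_mono hoelder_quotient_le
        hoelder_le_closure[OF cl_D_continuous[OF assms(3)] assms(1) H]) auto
  ultimately have "schauder_norm m \<alpha> \<Omega> f \<le> of_nat (num_evals TYPE('n) m) * ennreal e"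
    unfolding schauder_norm_def num_evals_def
    by (auto simp: distrib_right intro: order_trans[OF add_mono])
  then show ?thesis
    using assms(2) by (simp add: ennreal_mult ennreal_of_nat_eq_real_of_nat)
qed

lemma schauder_diff:
  fixes \<Omega> :: "(real ^ 'n::finite) set"
  assumes "open \<Omega>" "f \<in> schauder_space m \<alpha> \<Omega>" "g \<in> schauder_space m \<alpha> \<Omega>"
  defines "h \<equiv> (\<lambda>x\<in>closure \<Omega>. f x - g x)"
  shows "h \<in> C_space m \<Omega>"
    and "\<And>\<eta> x. multi_order \<eta> \<le> m \<Longrightarrow> x \<in> closure \<Omega> \<Longrightarrow>
      cl_D \<Omega> \<eta> h x = cl_D \<Omega> \<eta> f x - cl_D \<Omega> \<eta> g x"
    and "\<And>\<eta> p. multi_order \<eta> \<le> m \<Longrightarrow> p \<in> off_diagonal (closure \<Omega>) \<Longrightarrow>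
      hoelder_diff \<alpha> (cl_D \<Omega> \<eta> h) p =
        hoelder_diff \<alpha> (cl_D \<Omega> \<eta> f) p - hoelder_diff \<alpha> (cl_D \<Omega> \<eta> g) p"
proof -
  have C: "f \<in> C_space m \<Omega>" "g \<in> C_space m \<Omega>" using assms by (auto simp: schauder_space_def)
  have h: "h = (\<lambda>x\<in>closure \<Omega>. 1 * f x + (-1) * g x)" by (auto simp: h_def)
  show "h \<in> C_space m \<Omega>" unfolding h by (rule C_space_lincomb(1)[OF assms(1) C])
  show D: "cl_D \<Omega> \<eta> h x = cl_D \<Omega> \<eta> f x - cl_D \<Omega> \<eta> g x"
    if "multi_order \<eta> \<le> m" "x \<in> closure \<Omega>" for \<eta> x
    unfolding h using C_space_lincomb(2)[OF assms(1) C that, of 1 "-1"] by simp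
  show "hoelder_diff \<alpha> (cl_D \<Omega> \<eta> h) p =
        hoelder_diff \<alpha> (cl_D \<Omega> \<eta> f) p - hoelder_diff \<alpha> (cl_D \<Omega> \<eta> g) p"
    if "multi_order \<eta> \<le> m" "p \<in> off_diagonal (closure \<Omega>)" for \<eta> p
    using that(2) by (cases p) (auto simp: hoelder_diff_def D[OF that(1)] diff_divide_distrib)
qed

lemma off_diagonal_mono: "A \<subseteq> B \<Longrightarrow> off_diagonal A \<subseteq> off_diagonal B"
  by (auto simp: off_diagonal_def)

lemma schauder_dist_le:
  fixes \<Omega> :: "(real ^ 'n::finite) set" and e :: real
  assumes "open \<Omega>" "0 < \<alpha>" "0 \<le> e" "f \<in> schauder_space m \<alpha> \<Omega>" "g \<in> schauder_space m \<alpha> \<Omega>"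
    and D: "\<And>\<eta> x. multi_order \<eta> \<le> m \<Longrightarrow> x \<in> \<Omega> \<Longrightarrow> \<bar>cl_D \<Omega> \<eta> f x - cl_D \<Omega> \<eta> g x\<bar> \<le> e"
    and H: "\<And>\<eta> p. multi_order \<eta> = m \<Longrightarrow> p \<in> off_diagonal \<Omega> \<Longrightarrow>
      \<bar>hoelder_diff \<alpha> (cl_D \<Omega> \<eta> f) p - hoelder_diff \<alpha> (cl_D \<Omega> \<eta> g) p\<bar> \<le> e"
  shows "schauder_dist m \<alpha> \<Omega> f g \<le> num_evals TYPE('n) m * e"
proof -
  note sd = schauder_diff[OF assms(1,4,5)]
  have "schauder_norm m \<alpha> \<Omega> (\<lambda>x\<in>closure \<Omega>. f x - g x) \<le> ennreal (num_evals TYPE('n) m * e)"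
  proof (rule schauder_norm_le[OF assms(2,3) sd(1)])
    fix \<eta> :: "'n \<Rightarrow> nat" and x assume "multi_order \<eta> \<le> m" "x \<in> \<Omega>"
    then show "\<bar>cl_D \<Omega> \<eta> (\<lambda>x\<in>closure \<Omega>. f x - g x) x\<bar> \<le> e"
      using D sd(2)[of \<eta> x] closure_subset[of \<Omega>] by auto
  next
    fix \<eta> :: "'n \<Rightarrow> nat" and p assume "multi_order \<eta> = m" "p \<in> off_diagonal \<Omega>"
    then show "\<bar>hoelder_diff \<alpha> (cl_D \<Omega> \<eta> (\<lambda>x\<in>closure \<Omega>. f x - g x)) p\<bar> \<le> e"
      using H[of \<eta> p] sd(3)[of \<eta> p] off_diagonal_mono[OF closure_subset, of \<Omega>] by auto
  qed
  then show ?thesis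
    using assms(3-5) by (auto simp: schauder_dist_def intro: enn2real_leI)
qed

text \<open>Together with \<open>schauder_dist_le\<close> this makes the distance comparable, up to
  the factor \<open>num_evals\<close>, to the largest pointwise deviation of derivatives and
  top-order quotients.\<close>

lemma schauder_dist_ge:
  fixes \<Omega> :: "(real ^ 'n::finite) set"
  assumes "open \<Omega>" "bounded \<Omega>" "f \<in> schauder_space m \<alpha> \<Omega>" "g \<in> schauder_space m \<alpha> \<Omega>"
  shows "\<And>\<eta> x. multi_order \<eta> \<le> m \<Longrightarrow> x \<in> closure \<Omega> \<Longrightarrow>
      \<bar>cl_D \<Omega> \<eta> f x - cl_D \<Omega> \<eta> g x\<bar> \<le> schauder_dist m \<alpha> \<Omega> f g"
    and "\<And>\<eta> p. multi_order \<eta> = m \<Longrightarrow> p \<in> off_diagonal (closure \<Omega>) \<Longrightarrow>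
      \<bar>hoelder_diff \<alpha> (cl_D \<Omega> \<eta> f) p - hoelder_diff \<alpha> (cl_D \<Omega> \<eta> g) p\<bar> \<le> schauder_dist m \<alpha> \<Omega> f g"
proof -
  let ?h = "\<lambda>x\<in>closure \<Omega>. f x - g x"
  note sd = schauder_diff[OF assms(1,3,4)]
  \<comment> \<open>The norm of the difference is finite, so \<open>enn2real\<close> in the distance
    loses nothing.\<close>
  have *: "a \<le> schauder_dist m \<alpha> \<Omega> f g" if "ennreal a \<le> schauder_norm m \<alpha> \<Omega> ?h" for a
  proof -
    have "ennreal a \<le> ennreal (schauder_dist m \<alpha> \<Omega> f g)"
      using that schauder_norm_finite[OF assms(2) schauder_space_diff[OF assms(1,3,4)]] assms(3,4)
      by (simp add: schauder_dist_def)
    then show ?thesis by (simp add: schauder_dist_def ennreal_le_iff split: if_splits)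
  qed
  show "\<bar>cl_D \<Omega> \<eta> f x - cl_D \<Omega> \<eta> g x\<bar> \<le> schauder_dist m \<alpha> \<Omega> f g"
    if "multi_order \<eta> \<le> m" "x \<in> closure \<Omega>" for \<eta> x
    using *[OF abs_cl_D_le_schauder_norm[OF that]] sd(2)[OF that] by simp
  show "\<bar>hoelder_diff \<alpha> (cl_D \<Omega> \<eta> f) p - hoelder_diff \<alpha> (cl_D \<Omega> \<eta> g) p\<bar> \<le> schauder_dist m \<alpha> \<Omega> f g"
    if "multi_order \<eta> = m" "p \<in> off_diagonal (closure \<Omega>)" for \<eta> p
    using *[OF abs_hoelder_diff_le_schauder_norm[OF that]] sd(3)[of \<eta> p] that by simp
qed

section \<open>Lipschitz bound by the geodesic distance\<close>

text \<open>The increment of \<open>g\<close> is the integral of the gradient paired with the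
  velocity. Estimating every component of the velocity by its norm yields the factor
  \<open>CARD('n)\<close>.\<close>

lemma abs_diff_le_arc_len:
  fixes g :: "real ^ 'n::finite \<Rightarrow> real"
  assumes g: "\<And>x. x \<in> \<Omega> \<Longrightarrow> g differentiable (at x)"
    and B: "\<And>i x. x \<in> \<Omega> \<Longrightarrow> \<bar>partial_deriv i g x\<bar> \<le> B"
    and \<gamma>: "C1_arc \<gamma>" "path_image \<gamma> \<subseteq> \<Omega>" "pathstart \<gamma> = x" "pathfinish \<gamma> = y"
  shows "\<bar>g x - g y\<bar> \<le> real CARD('n) * B * arc_len \<gamma>"
proof -
  obtain \<gamma>' where c: "continuous_on {0..1} \<gamma>'"
    and d: "\<And>t. t \<in> {0..1} \<Longrightarrow> (\<gamma> has_vector_derivative \<gamma>' t) (at t within {0..1})"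
    using \<gamma>(1) by (auto simp: C1_arc_def)
  have mem: "\<gamma> t \<in> \<Omega>" if "t \<in> {0..1}" for t
    using \<gamma>(2) that by (auto simp: path_image_def)
  define h where "h t = (\<Sum>i\<in>UNIV. \<gamma>' t $ i * partial_deriv i g (\<gamma> t))" for t
  have "(g \<circ> \<gamma> has_vector_derivative h t) (at t within {0..1})" if "t \<in> {0..1}" for t
    unfolding h_def
    by (rule vector_derivative_diff_chain_within[OF d[OF that]])
      (rule has_derivative_at_withinI[OF has_derivative_partial_derivs[OF g[OF mem[OF that]]]])
  then have h: "(h has_integral (g \<circ> \<gamma>) 1 - (g \<circ> \<gamma>) 0) {0..1}"
    by (rule fundamental_theorem_of_calculus[OF zero_le_one])
  have "\<bar>h t\<bar> \<le> real CARD('n) * B * norm (\<gamma>' t)" if "t \<in> {0..1}" for t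
  proof -
    have "\<bar>h t\<bar> \<le> (\<Sum>i\<in>UNIV. \<bar>\<gamma>' t $ i * partial_deriv i g (\<gamma> t)\<bar>)"
      unfolding h_def by (rule sum_abs)
    also have "\<dots> \<le> (\<Sum>i\<in>(UNIV :: 'n set). norm (\<gamma>' t) * B)"
      unfolding abs_mult
      by (intro sum_mono mult_mono component_le_norm_cart B mem that) auto
    finally show ?thesis by (simp add: mult_ac)
  qed
  moreover have i: "(\<lambda>t. real CARD('n) * B * norm (\<gamma>' t)) integrable_on {0..1}"
    by (intro integrable_continuous_real continuous_intros c)
  ultimately have "norm (integral {0..1} h) \<le> integral {0..1} (\<lambda>t. real CARD('n) * B * norm (\<gamma>' t))"
    using h by (intro integral_norm_bound_integral) (auto simp: has_integral_integrable)
  also have "\<dots> = real CARD('n) * B * integral {0..1} (\<lambda>t. norm (\<gamma>' t))"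
    by simp
  \<comment> \<open>\<open>arc_len\<close> is defined through \<open>vector_derivative\<close>,
    which agrees with \<open>\<gamma>'\<close> by uniqueness of derivatives within the interval, end
    points included.\<close>
  also have "integral {0..1} (\<lambda>t. norm (\<gamma>' t)) = arc_len \<gamma>"
    unfolding arc_len_def
    by (intro integral_cong) (simp add: vector_derivative_within_closed_interval[OF _ _ d])
  finally show ?thesis
    using integral_unique[OF h] \<gamma>(3,4) by (simp add: pathstart_def pathfinish_def abs_minus_commute)
qed

text \<open>The infimum defining the geodesic distance need not be attained, so the bound along arcs
  is applied to an almost shortest one and the excess is absorbed by an arbitrary
  \<open>e\<close>.\<close>

lemma abs_diff_le_geodesic_const:
  fixes g :: "real ^ 'n::finite \<Rightarrow> real"
  assumes fin: "geodesic_const \<Omega> < \<infinity>"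
    and g: "\<And>x. x \<in> \<Omega> \<Longrightarrow> g differentiable (at x)"
    and B: "0 \<le> B" "\<And>i x. x \<in> \<Omega> \<Longrightarrow> \<bar>partial_deriv i g x\<bar> \<le> B"
    and xy: "x \<in> \<Omega>" "y \<in> \<Omega>"
  shows "\<bar>g x - g y\<bar> \<le> real CARD('n) * B * enn2real (geodesic_const \<Omega>) * norm (x - y)"
proof (cases "x = y")
  case False
  let ?b = "real CARD('n) * B" and ?r = "norm (x - y)"
  have r: "?r > 0" using False by simp
  have "geodesic_dist \<Omega> x y * ennreal (inverse ?r) \<le> geodesic_const \<Omega>"
    unfolding geodesic_const_def by (rule SUP_upper2[of "(x, y)"]) (use xy False in auto)
  then have "geodesic_dist \<Omega> x y * ennreal (inverse ?r) * ennreal ?r \<le> geodesic_const \<Omega> * ennreal ?r"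
    by (rule mult_right_mono) simp
  moreover have "ennreal (inverse ?r) * ennreal ?r = 1"
    using r by (simp add: ennreal_mult'[symmetric])
  ultimately have "geodesic_dist \<Omega> x y \<le> geodesic_const \<Omega> * ennreal ?r"
    by (simp add: mult.assoc)
  also have "\<dots> = ennreal (enn2real (geodesic_const \<Omega>) * ?r)"
    using fin by (simp add: ennreal_mult)
  finally have gd: "geodesic_dist \<Omega> x y \<le> ennreal (enn2real (geodesic_const \<Omega>) * ?r)" .
  have "\<bar>g x - g y\<bar> \<le> ?b * (enn2real (geodesic_const \<Omega>) * ?r)"
  proof (rule field_le_epsilon)
    fix e :: real assume e: "0 < e"
    \<comment> \<open>The permitted excess length, chosen with \<open>?b * d \<le> e\<close>; adding
      1 covers the case \<open>?b = 0\<close>.\<close>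
    define d where "d = e / (?b + 1)"
    have b: "?b \<ge> 0" using B(1) by simp
    have d: "d > 0" "?b * d \<le> e" using e b by (auto simp: d_def field_simps add_nonneg_pos)
    have "ennreal (enn2real (geodesic_const \<Omega>) * ?r) < ennreal (enn2real (geodesic_const \<Omega>) * ?r + d)"
      using d(1) by (intro ennreal_lessI) (auto intro: add_nonneg_pos)
    with gd have "geodesic_dist \<Omega> x y < ennreal (enn2real (geodesic_const \<Omega>) * ?r + d)"
      by (rule order_le_less_trans)
    then obtain \<gamma> where \<gamma>: "C1_arc \<gamma>" "path_image \<gamma> \<subseteq> \<Omega>" "pathstart \<gamma> = x" "pathfinish \<gamma> = y"
      "ennreal (arc_len \<gamma>) < ennreal (enn2real (geodesic_const \<Omega>) * ?r + d)"
      unfolding geodesic_dist_def INF_less_iff by auto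
    have "arc_len \<gamma> \<le> enn2real (geodesic_const \<Omega>) * ?r + d"
      using \<gamma>(5) ennreal_leI[of _ "arc_len \<gamma>"] by (meson leD linear)
    then have "?b * arc_len \<gamma> \<le> ?b * (enn2real (geodesic_const \<Omega>) * ?r) + ?b * d"
      using mult_left_mono[OF _ b] by (simp add: distrib_left[symmetric])
    then show "\<bar>g x - g y\<bar> \<le> ?b * (enn2real (geodesic_const \<Omega>) * ?r) + e"
      using abs_diff_le_arc_len[OF g B(2) \<gamma>(1-4)] d(2) by linarith
  qed
  then show ?thesis by (simp add: mult_ac)
qed simp

section \<open>Completeness\<close>

text \<open>The theorem on limits of derivatives wants a convex domain, so it is applied on a ball
  around \<open>x\<close>. The partial derivatives of the limit are then read off from uniqueness of
  its derivative, evaluated at axis vectors.\<close>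

lemma differentiable_uniform_limit_partial_derivs:
  fixes f :: "nat \<Rightarrow> real ^ 'n::finite \<Rightarrow> real"
  assumes "open \<Omega>"
    and f: "\<And>n x. x \<in> \<Omega> \<Longrightarrow> f n differentiable (at x)"
    and lim: "\<And>x. x \<in> \<Omega> \<Longrightarrow> (\<lambda>n. f n x) \<longlonglongrightarrow> F x"
    and G: "\<And>i. uniform_limit \<Omega> (\<lambda>n. partial_deriv i (f n)) (G i) sequentially"
    and x: "x \<in> \<Omega>"
  shows "F differentiable (at x)" "partial_deriv i F x = G i x"
proof -
  obtain r where r: "r > 0" "ball x r \<subseteq> \<Omega>" using openE[OF assms(1) x] .
  let ?g' = "\<lambda>y v. \<Sum>i\<in>UNIV. v $ i * G i y"
  have "\<exists>g. \<forall>y\<in>ball x r. (\<lambda>n. f n y) \<longlonglongrightarrow> g y \<and> (g has_derivative ?g' y) (at y within ball x r)"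
  proof (rule has_derivative_sequence[where f' = "\<lambda>n y v. \<Sum>i\<in>UNIV. v $ i * partial_deriv i (f n) y"])
    show "(f n has_derivative (\<lambda>v. \<Sum>i\<in>UNIV. v $ i * partial_deriv i (f n) y)) (at y within ball x r)"
      if "y \<in> ball x r" for n y
      using that r(2)
      by (intro has_derivative_at_withinI[OF has_derivative_partial_derivs] f) auto
    show "\<forall>\<^sub>F n in sequentially. \<forall>y\<in>ball x r. \<forall>v.
        norm ((\<Sum>i\<in>UNIV. v $ i * partial_deriv i (f n) y) - ?g' y v) \<le> e * norm v"
      if e: "e > 0" for e
    proof -
      \<comment> \<open>A share of \<open>e / CARD('n)\<close> for each coordinate: as
        \<open>\<bar>v $ i\<bar> \<le> norm v\<close>, the errors of the gradient sum to at most
        \<open>e * norm v\<close>.\<close>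
      have "\<forall>\<^sub>F n in sequentially. \<forall>i\<in>UNIV. \<forall>y\<in>\<Omega>.
          dist (partial_deriv i (f n) y) (G i y) < e / CARD('n)"
      proof (rule eventually_ball_finite[OF finite], rule ballI)
        fix i show "\<forall>\<^sub>F n in sequentially. \<forall>y\<in>\<Omega>. dist (partial_deriv i (f n) y) (G i y) < e / CARD('n)"
          by (rule uniform_limitD[OF G]) (use e in simp)
      qed
      then show ?thesis
      proof eventually_elim
        case (elim n)
        show ?case
        proof (intro ballI allI)
          fix y v assume "y \<in> ball x r"
          then have y: "y \<in> \<Omega>" using r(2) by auto
          have "\<bar>(\<Sum>i\<in>UNIV. v $ i * partial_deriv i (f n) y) - ?g' y v\<bar> =
              \<bar>\<Sum>i\<in>UNIV. v $ i * (partial_deriv i (f n) y - G i y)\<bar>"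
            by (simp add: sum_subtractf right_diff_distrib)
          also have "\<dots> \<le> (\<Sum>i\<in>UNIV. \<bar>v $ i * (partial_deriv i (f n) y - G i y)\<bar>)"
            by (rule sum_abs)
          also have "\<dots> \<le> (\<Sum>i\<in>(UNIV :: 'n set). norm v * (e / CARD('n)))"
            unfolding abs_mult
          proof (intro sum_mono mult_mono component_le_norm_cart)
            fix i show "\<bar>partial_deriv i (f n) y - G i y\<bar> \<le> e / CARD('n)"
              using elim y by (simp add: dist_real_def less_imp_le)
          qed auto
          finally show "norm ((\<Sum>i\<in>UNIV. v $ i * partial_deriv i (f n) y) - ?g' y v) \<le> e * norm v"
            by (simp add: mult_ac)
        qed
      qed
    qed
    show "(\<lambda>n. f n x) \<longlonglongrightarrow> F x" by (rule lim[OF x])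
  qed (use r in simp_all)
  then obtain g where g: "\<And>y. y \<in> ball x r \<Longrightarrow> (\<lambda>n. f n y) \<longlonglongrightarrow> g y"
    "\<And>y. y \<in> ball x r \<Longrightarrow> (g has_derivative ?g' y) (at y within ball x r)" by blast
  have "g y = F y" if "y \<in> ball x r" for y
    using LIMSEQ_unique[OF g(1)[OF that] lim[OF subsetD[OF r(2) that]]] .
  moreover have "(g has_derivative ?g' x) (at x)"
    using g(2)[of x] r(1) by (simp add: at_within_open[of x "ball x r"])
  ultimately have F: "(F has_derivative ?g' x) (at x)"
    using r(1) by (intro has_derivative_transform_within_open[of g "?g' x" x UNIV "ball x r" F]) simp_all
  then show "F differentiable (at x)" by (auto simp: differentiable_def)
  from has_derivative_unique[OF has_derivative_partial_derivs[OF this] F]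
  have "(\<Sum>k\<in>UNIV. axis i 1 $ k * partial_deriv k F x) = ?g' x (axis i 1)" by (rule fun_cong)
  moreover have "(\<Sum>k\<in>UNIV. axis i 1 $ k * c k) = c i" for c :: "'n \<Rightarrow> real"
  proof -
    have "axis i 1 $ k * c k = (if k = i then c k else 0)" for k by (simp add: axis_def)
    then show ?thesis by simp
  qed
  ultimately show "partial_deriv i F x = G i x"
    by simp
qed

text \<open>Limits are indexed by lists so that the previous lemma reads: the \<open>i\<close>-th
  partial derivative of \<open>G js\<close> is \<open>G (i # js)\<close>. Smoothness follows by
  induction on the number of derivatives left, ending with uniform limits of continuous
  functions.\<close>

lemma cont_diff_on_uniform_limit:
  fixes f :: "nat \<Rightarrow> real ^ 'n::finite \<Rightarrow> real"
  assumes "open \<Omega>" "\<And>n. cont_diff_on m \<Omega> (f n)"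
    and lim: "\<And>js. length js \<le> m \<Longrightarrow>
      uniform_limit \<Omega> (\<lambda>n. foldr partial_deriv js (f n)) (G js) sequentially"
  shows "cont_diff_on m \<Omega> (G [])"
    and "\<And>js x. length js \<le> m \<Longrightarrow> x \<in> \<Omega> \<Longrightarrow> foldr partial_deriv js (G []) x = G js x"
proof -
  have f: "cont_diff_on k \<Omega> (foldr partial_deriv js (f n))" if "length js + k \<le> m" for js k n
    by (rule cont_diff_on_foldr_partial_deriv[OF cont_diff_on_mono[OF assms(2) that]])
  have step: "G js differentiable (at x)" "partial_deriv i (G js) x = G (i # js) x"
    if js: "Suc (length js) \<le> m" and x: "x \<in> \<Omega>" for js x i
  proof -
    have "cont_diff_on (Suc 0) \<Omega> (foldr partial_deriv js (f n))" for n
      using js by (intro f) simp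
    then have 1: "foldr partial_deriv js (f n) differentiable (at x)" if "x \<in> \<Omega>" for n x
      using that by simp
    have 2: "(\<lambda>n. foldr partial_deriv js (f n) x) \<longlonglongrightarrow> G js x" if "x \<in> \<Omega>" for x
      using lim[of js] js that by (auto intro: tendsto_uniform_limitI)
    have 3: "uniform_limit \<Omega> (\<lambda>n. partial_deriv i (foldr partial_deriv js (f n))) (G (i # js)) sequentially" for i
      using lim[of "i # js"] js by simp
    show "G js differentiable (at x)" "partial_deriv i (G js) x = G (i # js) x"
      using differentiable_uniform_limit_partial_derivs[where f = "\<lambda>n. foldr partial_deriv js (f n)", OF assms(1) 1 2 3 x]
      by blast+
  qed
  have "cont_diff_on k \<Omega> (G js)" if "length js + k \<le> m" for js k
    using that
  proof (induction k arbitrary: js)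
    case 0
    have "continuous_on \<Omega> (foldr partial_deriv js (f n))" for n
      using f[of js 0 n] 0 by simp
    then show ?case
      using uniform_limit_theorem[OF _ lim[of js]] 0 by simp
  next
    case (Suc k)
    have "cont_diff_on k \<Omega> (partial_deriv i (G js))" for i
      using Suc.IH[of "i # js"] Suc.prems cont_diff_on_cong[OF assms(1) step(2)[of js]] by simp
    then show ?case
      using step(1)[of js] Suc.prems by simp
  qed
  then show "cont_diff_on m \<Omega> (G [])" by simp
  show "foldr partial_deriv js (G []) x = G js x" if "length js \<le> m" "x \<in> \<Omega>" for js x
    using that
  proof (induction js arbitrary: x)
    case (Cons i js)
    then have "partial_deriv i (foldr partial_deriv js (G [])) x = partial_deriv i (G js) x"
      by (intro partial_deriv_cong[OF assms(1)]) auto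
    then show ?case using step(2)[of js x i] Cons.prems by simp
  qed simp
qed

text \<open>The extended derivatives converge uniformly on the closure. On \<open>\<Omega>\<close>
  their limits are the derivatives of the limit function, and on the closure they are the continuous
  extensions that membership in \<open>C_space\<close> requires.\<close>

lemma schauder_complete:
  fixes \<Omega> :: "(real ^ 'n::finite) set"
  assumes "open \<Omega>" "bounded \<Omega>" "0 < \<alpha>"
  shows "Metric_space.mcomplete (schauder_space m \<alpha> \<Omega>) (schauder_dist m \<alpha> \<Omega>)"
proof -
  interpret Metric_space "schauder_space m \<alpha> \<Omega>" "schauder_dist m \<alpha> \<Omega>"
    by (rule schauder_metric[OF assms(1,2)])
  show ?thesis
    unfolding mcomplete_def
  proof (intro allI impI)
    fix \<sigma> assume "MCauchy \<sigma>"
    then have M: "\<sigma> n \<in> schauder_space m \<alpha> \<Omega>"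
      and C: "e > 0 \<Longrightarrow> \<exists>N. \<forall>n n'. N \<le> n \<longrightarrow> N \<le> n' \<longrightarrow> schauder_dist m \<alpha> \<Omega> (\<sigma> n) (\<sigma> n') < e" for e n
      unfolding MCauchy_def by auto
    have \<sigma>: "\<sigma> n \<in> C_space m \<Omega>" for n using M by (simp add: schauder_space_def)
    note ge = schauder_dist_ge[OF assms(1,2) M M]
    have "\<exists>g. uniform_limit (closure \<Omega>) (\<lambda>n. cl_D \<Omega> \<eta> (\<sigma> n)) g sequentially"
      if "multi_order \<eta> \<le> m" for \<eta>
    proof -
      have "uniformly_Cauchy_on (closure \<Omega>) (\<lambda>n. cl_D \<Omega> \<eta> (\<sigma> n))"
      proof (rule uniformly_Cauchy_onI)
        fix e :: real assume "e > 0"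
        from C[OF this] show "\<exists>N. \<forall>x\<in>closure \<Omega>. \<forall>n\<ge>N. \<forall>n'\<ge>N. dist (cl_D \<Omega> \<eta> (\<sigma> n) x) (cl_D \<Omega> \<eta> (\<sigma> n') x) < e"
          unfolding dist_real_def using ge(1)[OF that] by (meson le_less_trans)
      qed
      then show ?thesis
        using Cauchy_uniformly_convergent uniformly_convergent_on_def by blast
    qed
    then obtain G where G: "\<And>\<eta>. multi_order \<eta> \<le> m \<Longrightarrow>
        uniform_limit (closure \<Omega>) (\<lambda>n. cl_D \<Omega> \<eta> (\<sigma> n)) (G \<eta>) sequentially"
      by metis
    have Gc: "continuous_on (closure \<Omega>) (G \<eta>)" if "multi_order \<eta> \<le> m" for \<eta>
      using uniform_limit_theorem[OF _ G[OF that]] cl_D_continuous[OF \<sigma> that] by simp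
    \<comment> \<open>\<open>count (mset [])\<close> is the zero multi-index, in the form of the
      list-indexed family \<open>G (count (mset js))\<close>. The restriction makes \<open>f\<close>
      extensional.\<close>
    define f where "f = restrict (G (count (mset []))) (closure \<Omega>)"
    have f: "f x = G (count (mset [])) x" if "x \<in> \<Omega>" for x
      using that closure_subset[of \<Omega>] by (auto simp: f_def)
    have \<sigma>m: "cont_diff_on m \<Omega> (\<sigma> n)" for n using \<sigma> by (simp add: C_space_def)
    have ul: "uniform_limit \<Omega> (\<lambda>n. foldr partial_deriv js (\<sigma> n)) (G (count (mset js))) sequentially"
      if "length js \<le> m" for js
    proof -
      have o: "multi_order (count (mset js)) \<le> m" using that by (simp add: multi_order_count)
      have "cl_D \<Omega> (count (mset js)) (\<sigma> n) x = foldr partial_deriv js (\<sigma> n) x" if "x \<in> \<Omega>" for n x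
        using cl_D_eq_partial_D[OF \<sigma> o that]
          partial_D_eq_foldr[OF assms(1) cont_diff_on_mono[OF \<sigma>m \<open>length js \<le> m\<close>] that] by simp
      moreover have "uniform_limit \<Omega> (\<lambda>n. cl_D \<Omega> (count (mset js)) (\<sigma> n)) (G (count (mset js))) sequentially"
        by (rule uniform_limit_on_subset[OF G[OF o] closure_subset])
      ultimately show ?thesis
        by (subst (asm) uniform_limit_cong) auto
    qed
    have "cont_diff_on m \<Omega> (G (count (mset [])))"
      by (rule cont_diff_on_uniform_limit(1)[OF assms(1) \<sigma>m]) (rule ul)
    then have fm: "cont_diff_on m \<Omega> f"
      using cont_diff_on_cong[where f = f and g = "G (count (mset []))", OF assms(1) f] by simp
    have lim: "foldr partial_deriv js (G (count (mset []))) x = G (count (mset js)) x"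
      if "length js \<le> m" "x \<in> \<Omega>" for js x
      by (rule cont_diff_on_uniform_limit(2)[where G = "\<lambda>js. G (count (mset js))", OF assms(1) \<sigma>m _ that])
        (rule ul)
    have ext: "is_cl_extension \<Omega> (partial_D \<eta> f) (G \<eta>)" if "multi_order \<eta> \<le> m" for \<eta>
    proof -
      obtain js where js: "count (mset js) = \<eta>" by (rule multi_index_list)
      then have len: "length js \<le> m" using that multi_order_count by metis
      have "partial_D \<eta> f x = G \<eta> x" if "x \<in> \<Omega>" for x
        using lim[OF len that] partial_D_eq_foldr[OF assms(1) cont_diff_on_mono[OF fm len] that]
          foldr_partial_deriv_cong[where js = js, OF assms(1) f that] js by simp
      then show ?thesis using Gc[OF that] by (simp add: is_cl_extension_def)
    qed
    have fC: "f \<in> C_space m \<Omega>"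
      using fm ext Gc[of "count (mset [])"] by (auto simp: C_space_def f_def multi_order_count[of "[]", simplified] cong: continuous_on_cong)
    have D: "cl_D \<Omega> \<eta> f x = G \<eta> x" if "multi_order \<eta> \<le> m" "x \<in> closure \<Omega>" for \<eta> x
      using is_cl_extension_unique[OF cl_D_extension[OF fC that(1)] ext[OF that(1)] that(2)] .
    have lD: "(\<lambda>n. cl_D \<Omega> \<eta> (\<sigma> n) x) \<longlonglongrightarrow> cl_D \<Omega> \<eta> f x"
      if "multi_order \<eta> \<le> m" "x \<in> closure \<Omega>" for \<eta> x
      unfolding D[OF that] using G[OF that(1)] that(2) by (rule tendsto_uniform_limitI)
    have lH: "(\<lambda>n. hoelder_diff \<alpha> (cl_D \<Omega> \<eta> (\<sigma> n)) p) \<longlonglongrightarrow> hoelder_diff \<alpha> (cl_D \<Omega> \<eta> f) p"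
      if "multi_order \<eta> = m" "p \<in> off_diagonal (closure \<Omega>)" for \<eta> p
      using that by (cases p) (auto simp: hoelder_diff_def intro!: tendsto_intros lD)
    have close: "\<exists>N. \<forall>n\<ge>N. (\<forall>\<eta> x. multi_order \<eta> \<le> m \<longrightarrow> x \<in> closure \<Omega> \<longrightarrow>
          \<bar>cl_D \<Omega> \<eta> (\<sigma> n) x - cl_D \<Omega> \<eta> f x\<bar> \<le> e) \<and>
        (\<forall>\<eta> p. multi_order \<eta> = m \<longrightarrow> p \<in> off_diagonal (closure \<Omega>) \<longrightarrow>
          \<bar>hoelder_diff \<alpha> (cl_D \<Omega> \<eta> (\<sigma> n)) p - hoelder_diff \<alpha> (cl_D \<Omega> \<eta> f) p\<bar> \<le> e)"
      if e: "e > 0" for e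
    proof -
      obtain N where N: "\<And>n n'. N \<le> n \<Longrightarrow> N \<le> n' \<Longrightarrow> schauder_dist m \<alpha> \<Omega> (\<sigma> n) (\<sigma> n') < e"
        using C[OF e] by blast
      \<comment> \<open>Keep \<open>n\<close> fixed and let \<open>n'\<close> tend to infinity in
        the Cauchy estimate. The same \<open>N\<close> serves all points and multi-indices, so
        pointwise convergence becomes a uniform estimate.\<close>
      have *: "\<bar>a n - b\<bar> \<le> e"
        if "a \<longlonglongrightarrow> b" "\<And>n n'. \<bar>a n - a n'\<bar> \<le> schauder_dist m \<alpha> \<Omega> (\<sigma> n) (\<sigma> n')" "N \<le> n" for a b n
      proof (rule tendsto_upperbound)
        show "(\<lambda>n'. \<bar>a n - a n'\<bar>) \<longlonglongrightarrow> \<bar>a n - b\<bar>" by (intro tendsto_intros that(1))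
        show "\<forall>\<^sub>F n' in sequentially. \<bar>a n - a n'\<bar> \<le> e"
          using eventually_ge_at_top[of N]
          by eventually_elim (use that(2) N[OF that(3)] in \<open>meson le_less_trans less_imp_le\<close>)
      qed simp
      show ?thesis
        by (rule exI[of _ N]) (auto intro!: *[OF lD ge(1)] *[OF lH ge(2)])
    qed
    have fM: "f \<in> schauder_space m \<alpha> \<Omega>"
    proof -
      \<comment> \<open>A member of the sequence whose quotients are within 1 of those of
        \<open>f\<close>: its finite norm plus 1 bounds the quotients of \<open>f\<close>.\<close>
      obtain N where N: "\<And>\<eta> p. multi_order \<eta> = m \<Longrightarrow> p \<in> off_diagonal (closure \<Omega>) \<Longrightarrow>
          \<bar>hoelder_diff \<alpha> (cl_D \<Omega> \<eta> (\<sigma> N)) p - hoelder_diff \<alpha> (cl_D \<Omega> \<eta> f) p\<bar> \<le> 1"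
        using close[OF zero_less_one] order_refl by meson
      let ?B = "enn2real (schauder_norm m \<alpha> \<Omega> (\<sigma> N))"
      have "\<bar>hoelder_diff \<alpha> (cl_D \<Omega> \<eta> f) p\<bar> \<le> ?B + 1"
        if "multi_order \<eta> = m" "p \<in> off_diagonal (closure \<Omega>)" for \<eta> p
      proof -
        have "ennreal \<bar>hoelder_diff \<alpha> (cl_D \<Omega> \<eta> (\<sigma> N)) p\<bar> \<le> ennreal ?B"
          using abs_hoelder_diff_le_schauder_norm[OF that, of \<alpha> "\<sigma> N"]
            schauder_norm_finite[OF assms(2) M] by simp
        then show ?thesis using N[OF that] by (auto simp: ennreal_le_iff)
      qed
      then have "hoelder_quotient \<alpha> (closure \<Omega>) (cl_D \<Omega> \<eta> f) \<le> ennreal (?B + 1)" if "multi_order \<eta> = m" for \<eta>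
        using that by (intro hoelder_quotient_le) auto
      then have "hoelder_quotient \<alpha> (closure \<Omega>) (cl_D \<Omega> \<eta> f) < \<infinity>" if "multi_order \<eta> = m" for \<eta>
        using that le_less_trans[OF _ ennreal_less_top] by (metis infinity_ennreal_def)
      then show ?thesis using fC by (simp add: schauder_space_def)
    qed
    have "limitin mtopology \<sigma> f sequentially"
      unfolding limit_metric_sequentially
    proof (intro conjI fM allI impI)
      fix \<epsilon> :: real assume \<epsilon>: "\<epsilon> > 0"
      \<comment> \<open>Adding 1 to the denominator makes \<open>num_evals * e < \<epsilon>\<close>
        strict.\<close>
      define e where "e = \<epsilon> / (real (num_evals TYPE('n) m) + 1)"
      have e: "e > 0" "real (num_evals TYPE('n) m) * e < \<epsilon>"
        using \<epsilon> by (auto simp: e_def field_simps add_nonneg_pos)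
      obtain N where N: "\<And>n. n \<ge> N \<Longrightarrow> (\<forall>\<eta> x. multi_order \<eta> \<le> m \<longrightarrow> x \<in> closure \<Omega> \<longrightarrow>
          \<bar>cl_D \<Omega> \<eta> (\<sigma> n) x - cl_D \<Omega> \<eta> f x\<bar> \<le> e) \<and>
        (\<forall>\<eta> p. multi_order \<eta> = m \<longrightarrow> p \<in> off_diagonal (closure \<Omega>) \<longrightarrow>
          \<bar>hoelder_diff \<alpha> (cl_D \<Omega> \<eta> (\<sigma> n)) p - hoelder_diff \<alpha> (cl_D \<Omega> \<eta> f) p\<bar> \<le> e)"
        using close[OF e(1)] by blast
      have "schauder_dist m \<alpha> \<Omega> (\<sigma> n) f \<le> real (num_evals TYPE('n) m) * e" if "n \<ge> N" for n
        using N[OF that] e(1) closure_subset[of \<Omega>] off_diagonal_mono[OF closure_subset, of \<Omega>]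
        by (intro schauder_dist_le[OF assms(1,3) _ M fM]) auto
      then show "\<exists>N. \<forall>n\<ge>N. \<sigma> n \<in> schauder_space m \<alpha> \<Omega> \<and> schauder_dist m \<alpha> \<Omega> (\<sigma> n) f < \<epsilon>"
        using M e(2) le_less_trans by blast
    qed
    then show "\<exists>x. limitin mtopology \<sigma> x sequentially" by blast
  qed
qed

section \<open>Total boundedness\<close>

text \<open>Pigeonhole: \<open>h k\<close> rounds the finitely many values of \<open>k\<close> down
  to the grid of width \<open>\<delta>\<close>. Bounded values meet finitely many grid cells, and
  one representative for each cell that occurs is a net.\<close>

lemma finite_net_of_bounded_family:
  fixes \<phi> :: "'i \<Rightarrow> 'k \<Rightarrow> real"
  assumes "finite I" "\<And>i k. i \<in> I \<Longrightarrow> k \<in> K \<Longrightarrow> \<bar>\<phi> i k\<bar> \<le> B" "0 < \<delta>"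
  obtains K' where "finite K'" "K' \<subseteq> K"
    "\<And>k. k \<in> K \<Longrightarrow> \<exists>k'\<in>K'. \<forall>i\<in>I. \<bar>\<phi> i k - \<phi> i k'\<bar> < \<delta>"
proof -
  define h where "h k = (\<lambda>i\<in>I. \<lfloor>\<phi> i k / \<delta>\<rfloor>)" for k
  have "h ` K \<subseteq> PiE I (\<lambda>_. {\<lfloor>- B / \<delta>\<rfloor>..\<lfloor>B / \<delta>\<rfloor>})"
  proof (intro image_subsetI PiE_I)
    fix k i assume "k \<in> K" "i \<in> I"
    then have "- B \<le> \<phi> i k" "\<phi> i k \<le> B" using assms(2)[of i k] by auto
    then have "- B / \<delta> \<le> \<phi> i k / \<delta>" "\<phi> i k / \<delta> \<le> B / \<delta>"
      using assms(3) by (intro divide_right_mono; simp)+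
    then show "h k i \<in> {\<lfloor>- B / \<delta>\<rfloor>..\<lfloor>B / \<delta>\<rfloor>}"
      using floor_mono[of "- B / \<delta>" "\<phi> i k / \<delta>"] floor_mono[of "\<phi> i k / \<delta>" "B / \<delta>"] \<open>i \<in> I\<close>
      by (simp add: h_def)
  qed (simp add: h_def)
  then have "finite (h ` K)"
    by (rule finite_subset) (simp add: assms(1) finite_PiE)
  then obtain K' where K': "K' \<subseteq> K" "finite K'" "h ` K = h ` K'"
    by (metis finite_subset_image subset_refl)
  show thesis
  proof
    fix k assume "k \<in> K"
    then obtain k' where k': "k' \<in> K'" "h k = h k'" using K'(3) by blast
    have "\<bar>\<phi> i k - \<phi> i k'\<bar> < \<delta>" if "i \<in> I" for i
    proof -
      have "\<lfloor>\<phi> i k / \<delta>\<rfloor> = \<lfloor>\<phi> i k' / \<delta>\<rfloor>"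
        using fun_cong[OF k'(2), of i] that by (simp add: h_def)
      then have "\<bar>\<phi> i k / \<delta> - \<phi> i k' / \<delta>\<bar> < 1" by linarith
      then have "\<bar>\<phi> i k - \<phi> i k'\<bar> / \<delta> < 1"
        using assms(3) by (simp add: diff_divide_distrib[symmetric])
      then show ?thesis using assms(3) by simp
    qed
    then show "\<exists>k'\<in>K'. \<forall>i\<in>I. \<bar>\<phi> i k - \<phi> i k'\<bar> < \<delta>" using k'(1) by blast
  qed (use K' in auto)
qed

text \<open>Compactness comes from the closure, but the centres are kept in \<open>A\<close>, since
  equicontinuity will only be available between points of \<open>\<Omega>\<close>.\<close>

lemma bounded_finite_net:
  fixes A :: "'a::heine_borel set"
  assumes "bounded A" "0 < \<rho>"
  obtains P where "finite P" "P \<subseteq> A" "A \<subseteq> (\<Union>p\<in>P. ball p \<rho>)"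
proof -
  have "closure A \<subseteq> (\<Union>p\<in>A. ball p \<rho>)"
    using assms(2) by (auto simp: closure_approachable)
  from compactE_image[OF _ _ this] assms(1) obtain P where "P \<subseteq> A" "finite P" "closure A \<subseteq> (\<Union>p\<in>P. ball p \<rho>)"
    by (metis compact_closure open_ball)
  then show thesis using that closure_subset[of A] by blast
qed

section \<open>Uniform bounds and equicontinuity of bounded sets\<close>

lemma schauder_bounded_obtain:
  fixes \<Omega> :: "(real ^ 'n::finite) set"
  assumes "schauder_bounded m \<alpha> \<Omega> K"
  obtains B where "0 \<le> B"
    "\<And>k \<eta> x. k \<in> K \<Longrightarrow> multi_order \<eta> \<le> m \<Longrightarrow> x \<in> closure \<Omega> \<Longrightarrow> \<bar>cl_D \<Omega> \<eta> k x\<bar> \<le> B"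
    "\<And>k \<eta> p. k \<in> K \<Longrightarrow> multi_order \<eta> = m \<Longrightarrow> p \<in> off_diagonal (closure \<Omega>) \<Longrightarrow>
      \<bar>hoelder_diff \<alpha> (cl_D \<Omega> \<eta> k) p\<bar> \<le> B"
proof -
  define B where "B = enn2real (SUP k\<in>K. schauder_norm m \<alpha> \<Omega> k)"
  have le: "schauder_norm m \<alpha> \<Omega> k \<le> ennreal B" if "k \<in> K" for k
    using assms that by (auto simp: B_def schauder_bounded_def intro: SUP_upper)
  have B: "0 \<le> B" by (simp add: B_def)
  show thesis
  proof (rule that[OF B])
    fix k x and \<eta> :: "'n \<Rightarrow> nat" assume "k \<in> K" "multi_order \<eta> \<le> m" "x \<in> closure \<Omega>"
    then have "ennreal \<bar>cl_D \<Omega> \<eta> k x\<bar> \<le> ennreal B"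
      using abs_cl_D_le_schauder_norm le order_trans by blast
    then show "\<bar>cl_D \<Omega> \<eta> k x\<bar> \<le> B" using B by (simp add: ennreal_le_iff)
  next
    fix k p and \<eta> :: "'n \<Rightarrow> nat" assume "k \<in> K" "multi_order \<eta> = m" "p \<in> off_diagonal (closure \<Omega>)"
    then have "ennreal \<bar>hoelder_diff \<alpha> (cl_D \<Omega> \<eta> k) p\<bar> \<le> ennreal B"
      using abs_hoelder_diff_le_schauder_norm le order_trans by blast
    then show "\<bar>hoelder_diff \<alpha> (cl_D \<Omega> \<eta> k) p\<bar> \<le> B" using B by (simp add: ennreal_le_iff)
  qed
qed

text \<open>Below order \<open>m\<close>, each partial derivative of the derivative by
  \<open>js\<close> is the one by \<open>i # js\<close>, still of order at most \<open>m\<close> and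
  hence bounded by \<open>B\<close>; the geodesic estimate then applies.\<close>

lemma cl_D_lipschitz:
  fixes \<Omega> :: "(real ^ 'n::finite) set"
  assumes "open \<Omega>" "geodesic_const \<Omega> < \<infinity>" "k \<in> C_space m \<Omega>" "0 \<le> B"
    and B: "\<And>\<eta> x. multi_order \<eta> \<le> m \<Longrightarrow> x \<in> \<Omega> \<Longrightarrow> \<bar>cl_D \<Omega> \<eta> k x\<bar> \<le> B"
    and "multi_order \<eta> < m" "x \<in> \<Omega>" "y \<in> \<Omega>"
  shows "\<bar>cl_D \<Omega> \<eta> k x - cl_D \<Omega> \<eta> k y\<bar> \<le> real CARD('n) * B * enn2real (geodesic_const \<Omega>) * norm (x - y)"
proof -
  obtain js where js: "count (mset js) = \<eta>" by (rule multi_index_list)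
  have len: "Suc (length js) \<le> m" using assms(6) js multi_order_count[of js] by simp
  have km: "cont_diff_on m \<Omega> k" using assms(3) by (simp add: C_space_def)
  have D: "cl_D \<Omega> (count (mset ks)) k z = foldr partial_deriv ks k z" if "length ks \<le> m" "z \<in> \<Omega>" for ks z
    using cl_D_eq_partial_D[OF assms(3) _ that(2)] that(1)
      partial_D_eq_foldr[OF assms(1) cont_diff_on_mono[OF km that(1)] that(2)]
    by (simp add: multi_order_count)
  have "cont_diff_on (Suc 0) \<Omega> (foldr partial_deriv js k)"
    by (rule cont_diff_on_foldr_partial_deriv[OF cont_diff_on_mono[OF km]]) (use len in simp)
  then have d: "foldr partial_deriv js k differentiable (at z)" if "z \<in> \<Omega>" for z
    using that by simp
  have "\<bar>partial_deriv i (foldr partial_deriv js k) z\<bar> \<le> B" if "z \<in> \<Omega>" for i z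
    using B[OF _ that, of "count (mset (i # js))"] D[OF _ that, of "i # js"] len
      multi_order_count[of "i # js"] by simp
  from abs_diff_le_geodesic_const[OF assms(2) d assms(4) this assms(7,8)]
  show ?thesis
    using D[of js] js len assms(7,8) by simp
qed

lemma schauder_bounded_equicontinuous:
  fixes \<Omega> :: "(real ^ 'n::finite) set"
  assumes "open \<Omega>" "geodesic_const \<Omega> < \<infinity>" "0 < \<alpha>" "K \<subseteq> C_space m \<Omega>"
    "schauder_bounded m \<alpha> \<Omega> K" "0 < \<delta>"
  obtains \<rho> where "0 < \<rho>" "\<And>k \<eta> x y. k \<in> K \<Longrightarrow> multi_order \<eta> \<le> m \<Longrightarrow> x \<in> \<Omega> \<Longrightarrow> y \<in> \<Omega> \<Longrightarrow>
    dist x y < \<rho> \<Longrightarrow> \<bar>cl_D \<Omega> \<eta> k x - cl_D \<Omega> \<eta> k y\<bar> \<le> \<delta>"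
proof -
  obtain B where B: "0 \<le> B"
    "\<And>k \<eta> x. k \<in> K \<Longrightarrow> multi_order \<eta> \<le> m \<Longrightarrow> x \<in> closure \<Omega> \<Longrightarrow> \<bar>cl_D \<Omega> \<eta> k x\<bar> \<le> B"
    "\<And>k \<eta> p. k \<in> K \<Longrightarrow> multi_order \<eta> = m \<Longrightarrow> p \<in> off_diagonal (closure \<Omega>) \<Longrightarrow>
      \<bar>hoelder_diff \<alpha> (cl_D \<Omega> \<eta> k) p\<bar> \<le> B"
    using schauder_bounded_obtain[OF assms(5)] by blast
  define L where "L = real CARD('n) * B * enn2real (geodesic_const \<Omega>)"
  have L: "0 \<le> L" using B(1) by (simp add: L_def)
  \<comment> \<open>The first radius serves the Lipschitz bound with \<open>L\<close> in orders
    below \<open>m\<close>, the second the Hoelder bound with \<open>B\<close> in order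
    \<open>m\<close>. Adding 1 covers vanishing \<open>L\<close> or \<open>B\<close>.\<close>
  define \<rho> where "\<rho> = min (\<delta> / (L + 1)) ((\<delta> / (B + 1)) powr (1 / \<alpha>))"
  have sub: "x \<in> closure \<Omega>" if "x \<in> \<Omega>" for x using that closure_subset by blast
  show thesis
  proof (rule that)
    show "0 < \<rho>" using assms(6) L B(1) by (simp add: \<rho>_def add_nonneg_pos)
    fix k x y and \<eta> :: "'n \<Rightarrow> nat"
    assume k: "k \<in> K" and \<eta>: "multi_order \<eta> \<le> m" and xy: "x \<in> \<Omega>" "y \<in> \<Omega>" "dist x y < \<rho>"
    show "\<bar>cl_D \<Omega> \<eta> k x - cl_D \<Omega> \<eta> k y\<bar> \<le> \<delta>"
    proof (cases "multi_order \<eta> < m")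
      case True
      have "\<bar>cl_D \<Omega> \<eta> k x - cl_D \<Omega> \<eta> k y\<bar> \<le> L * norm (x - y)"
        unfolding L_def
        using cl_D_lipschitz[OF assms(1,2) _ B(1) B(2)[OF k _ sub] True xy(1,2)] assms(4) k by blast
      also have "\<dots> \<le> L * (\<delta> / (L + 1))"
        using xy(3) L by (intro mult_left_mono) (auto simp: \<rho>_def dist_norm)
      also have "\<dots> \<le> \<delta>"
        using L assms(6) by (simp add: field_simps add_nonneg_pos)
      finally show ?thesis .
    next
      case False
      show ?thesis
      proof (cases "x = y")
        case True
        then show ?thesis using assms(6) by simp
      next
        case ne: False
        have "\<bar>hoelder_diff \<alpha> (cl_D \<Omega> \<eta> k) (x, y)\<bar> \<le> B"
          using B(3)[OF k, of \<eta> "(x, y)"] False \<eta> xy sub ne by simp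
        then have "\<bar>cl_D \<Omega> \<eta> k x - cl_D \<Omega> \<eta> k y\<bar> \<le> B * norm (x - y) powr \<alpha>"
          using ne by (simp add: hoelder_diff_def divide_le_eq)
        also have "\<dots> \<le> B * ((\<delta> / (B + 1)) powr (1 / \<alpha>)) powr \<alpha>"
          using xy(3) B(1) assms(3) by (intro mult_left_mono powr_mono2) (auto simp: \<rho>_def dist_norm)
        also have "\<dots> = B * (\<delta> / (B + 1))"
          using assms(3,6) B(1) by (simp add: powr_powr)
        also have "\<dots> \<le> \<delta>"
          using B(1) assms(6) by (simp add: field_simps add_nonneg_pos)
        finally show ?thesis .
      qed
    qed
  qed
qed

section \<open>Finite nets from coverings with small oscillation\<close>

lemma schauder_finite_net:
  fixes \<Omega> :: "(real ^ 'n::finite) set" and \<delta> :: real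
  assumes "open \<Omega>" "bounded \<Omega>" "geodesic_const \<Omega> < \<infinity>" "0 < \<alpha>" "K \<subseteq> schauder_space m \<alpha> \<Omega>"
    and bdd: "schauder_bounded m \<alpha> \<Omega> K" and "0 < \<delta>"
    and fin: "finite \<F>" and cover: "\<Union>\<F> = off_diagonal \<Omega>"
    and diam: "\<And>F k \<eta>. F \<in> \<F> \<Longrightarrow> k \<in> K \<Longrightarrow> multi_order \<eta> = m \<Longrightarrow>
      diameter (hoelder_diff \<alpha> (cl_D \<Omega> \<eta> k) ` F) < \<delta>"
  obtains K' where "finite K'" "K' \<subseteq> K"
    "\<And>k. k \<in> K \<Longrightarrow> \<exists>k'\<in>K'. schauder_dist m \<alpha> \<Omega> k k' \<le> num_evals TYPE('n) m * (3 * \<delta>)"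
proof -
  have KC: "K \<subseteq> C_space m \<Omega>" using assms(5) by (auto simp: schauder_space_def)
  obtain \<rho> where \<rho>: "0 < \<rho>" "\<And>k \<eta> x y. k \<in> K \<Longrightarrow> multi_order \<eta> \<le> m \<Longrightarrow> x \<in> \<Omega> \<Longrightarrow> y \<in> \<Omega> \<Longrightarrow>
    dist x y < \<rho> \<Longrightarrow> \<bar>cl_D \<Omega> \<eta> k x - cl_D \<Omega> \<eta> k y\<bar> \<le> \<delta>"
    using schauder_bounded_equicontinuous[OF assms(1,3,4) KC bdd assms(7)] by metis
  obtain P where P: "finite P" "P \<subseteq> \<Omega>" "\<Omega> \<subseteq> (\<Union>p\<in>P. ball p \<rho>)"
    using bounded_finite_net[OF assms(2) \<rho>(1)] by metis
  obtain B where B: "0 \<le> B"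
    "\<And>k \<eta> x. k \<in> K \<Longrightarrow> multi_order \<eta> \<le> m \<Longrightarrow> x \<in> closure \<Omega> \<Longrightarrow> \<bar>cl_D \<Omega> \<eta> k x\<bar> \<le> B"
    "\<And>k \<eta> p. k \<in> K \<Longrightarrow> multi_order \<eta> = m \<Longrightarrow> p \<in> off_diagonal (closure \<Omega>) \<Longrightarrow>
      \<bar>hoelder_diff \<alpha> (cl_D \<Omega> \<eta> k) p\<bar> \<le> B"
    using schauder_bounded_obtain[OF bdd] by blast
  have sub: "\<Omega> \<subseteq> closure \<Omega>" "off_diagonal \<Omega> \<subseteq> off_diagonal (closure \<Omega>)"
    using closure_subset off_diagonal_mono by blast+
  obtain c where c: "\<And>F. F \<in> \<F> - {{}} \<Longrightarrow> c F \<in> F"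
    by (metis DiffE equals0I insertI1)
  have cO: "c F \<in> off_diagonal \<Omega>" if "F \<in> \<F> - {{}}" for F
    using c[OF that] cover that by blast
  let ?M = "{\<eta> :: 'n \<Rightarrow> nat. multi_order \<eta> \<le> m}" and ?E = "{\<eta> :: 'n \<Rightarrow> nat. multi_order \<eta> = m}"
  \<comment> \<open>The finitely many measurements of a member of \<open>K\<close>: derivatives at
    the net points (\<open>Inl\<close>) and top-order quotients at the sample points
    \<open>c F\<close> (\<open>Inr\<close>). Empty covering sets have no sample point and are left
    out.\<close>
  let ?I = "Inl ` (?M \<times> P) \<union> Inr ` (?E \<times> (\<F> - {{}}))"
  define \<phi> where "\<phi> i k = (case i of Inl (\<eta>, p) \<Rightarrow> cl_D \<Omega> \<eta> k p
    | Inr (\<eta>, F) \<Rightarrow> hoelder_diff \<alpha> (cl_D \<Omega> \<eta> k) (c F))" for i k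
  have "finite ?I" using P(1) fin by (simp add: finite_multi_order_le finite_multi_order)
  moreover have "\<bar>\<phi> i k\<bar> \<le> B" if "i \<in> ?I" "k \<in> K" for i k
  proof -
    have "\<bar>hoelder_diff \<alpha> (cl_D \<Omega> \<eta> k) (c F)\<bar> \<le> B" if "F \<in> \<F> - {{}}" "multi_order \<eta> = m" for \<eta> F
      using B(3)[OF \<open>k \<in> K\<close> that(2)] cO[OF that(1)] sub(2) by blast
    then show ?thesis
      using that(1) B(2)[OF that(2)] P(2) sub(1) by (fastforce simp: \<phi>_def)
  qed
  ultimately obtain K' where K': "finite K'" "K' \<subseteq> K"
    "\<And>k. k \<in> K \<Longrightarrow> \<exists>k'\<in>K'. \<forall>i\<in>?I. \<bar>\<phi> i k - \<phi> i k'\<bar> < \<delta>"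
    using finite_net_of_bounded_family[of ?I K \<phi> B \<delta>] assms(7) by metis
  show thesis
  proof (rule that[OF K'(1,2)])
    fix k assume k: "k \<in> K"
    then obtain k' where k': "k' \<in> K'" "\<And>i. i \<in> ?I \<Longrightarrow> \<bar>\<phi> i k - \<phi> i k'\<bar> < \<delta>"
      using K'(3) by blast
    have k'K: "k' \<in> K" using k' K'(2) by blast
    \<comment> \<open>Each comparison of \<open>k\<close> with \<open>k'\<close> takes three steps
      of size \<open>\<delta>\<close>: to the measuring point, across to \<open>k'\<close>, and
      back.\<close>
    have "schauder_dist m \<alpha> \<Omega> k k' \<le> num_evals TYPE('n) m * (3 * \<delta>)"
    proof (rule schauder_dist_le[OF assms(1,4)])
      fix \<eta> :: "'n \<Rightarrow> nat" and x assume \<eta>: "multi_order \<eta> \<le> m" and x: "x \<in> \<Omega>"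
      obtain p where p: "p \<in> P" "dist x p < \<rho>" using P(3) x by (auto simp: dist_commute)
      have "p \<in> \<Omega>" using p P(2) by blast
      then have "\<bar>cl_D \<Omega> \<eta> k x - cl_D \<Omega> \<eta> k p\<bar> \<le> \<delta>" "\<bar>cl_D \<Omega> \<eta> k' x - cl_D \<Omega> \<eta> k' p\<bar> \<le> \<delta>"
        using \<rho>(2)[OF _ \<eta> x _ p(2)] k k'K by blast+
      moreover have "\<bar>cl_D \<Omega> \<eta> k p - cl_D \<Omega> \<eta> k' p\<bar> < \<delta>"
        using k'(2)[of "Inl (\<eta>, p)"] \<eta> p(1) by (simp add: \<phi>_def)
      ultimately show "\<bar>cl_D \<Omega> \<eta> k x - cl_D \<Omega> \<eta> k' x\<bar> \<le> 3 * \<delta>" by linarith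
    next
      fix \<eta> :: "'n \<Rightarrow> nat" and p assume \<eta>: "multi_order \<eta> = m" and p: "p \<in> off_diagonal \<Omega>"
      then obtain F where F: "F \<in> \<F>" "p \<in> F" using cover by blast
      have F': "F \<in> \<F> - {{}}" using F by blast
      have osc: "\<bar>hoelder_diff \<alpha> (cl_D \<Omega> \<eta> l) p - hoelder_diff \<alpha> (cl_D \<Omega> \<eta> l) (c F)\<bar> < \<delta>" if "l \<in> K" for l
      proof -
        \<comment> \<open>\<open>diameter\<close> is a real supremum and controls distances only for
          bounded sets; boundedness comes from \<open>B\<close>.\<close>
        have "bounded (hoelder_diff \<alpha> (cl_D \<Omega> \<eta> l) ` F)"
          unfolding bounded_iff using B(3)[OF that \<eta>] F(1) cover sub(2)
          by (intro exI[of _ B]) auto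
        then have "dist (hoelder_diff \<alpha> (cl_D \<Omega> \<eta> l) p) (hoelder_diff \<alpha> (cl_D \<Omega> \<eta> l) (c F)) \<le>
            diameter (hoelder_diff \<alpha> (cl_D \<Omega> \<eta> l) ` F)"
          using F(2) c[OF F'] by (intro diameter_bounded_bound) auto
        then show ?thesis using diam[OF F(1) that \<eta>] by (simp add: dist_real_def)
      qed
      have "\<bar>hoelder_diff \<alpha> (cl_D \<Omega> \<eta> k) (c F) - hoelder_diff \<alpha> (cl_D \<Omega> \<eta> k') (c F)\<bar> < \<delta>"
        using k'(2)[of "Inr (\<eta>, F)"] \<eta> F' by (simp add: \<phi>_def)
      then show "\<bar>hoelder_diff \<alpha> (cl_D \<Omega> \<eta> k) p - hoelder_diff \<alpha> (cl_D \<Omega> \<eta> k') p\<bar> \<le> 3 * \<delta>"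
        using osc[OF k] osc[OF k'K] by linarith
    qed (use assms(5,7) k k'K in auto)
    then show "\<exists>k'\<in>K'. schauder_dist m \<alpha> \<Omega> k k' \<le> num_evals TYPE('n) m * (3 * \<delta>)"
      using k'(1) by blast
  qed
qed

section \<open>Finite open covers from finitely many bounded functions\<close>

lemma finite_open_cover_small_oscillation:
  fixes \<phi> :: "'i \<Rightarrow> 'a::topological_space \<Rightarrow> real"
  assumes "finite I" "\<And>i. i \<in> I \<Longrightarrow> continuous_on X (\<phi> i)"
    and "\<And>i p. i \<in> I \<Longrightarrow> p \<in> X \<Longrightarrow> \<bar>\<phi> i p\<bar> \<le> B" "0 < \<delta>"
  obtains \<F> where "finite \<F>" "\<And>F. F \<in> \<F> \<Longrightarrow> openin (top_of_set X) F" "\<Union>\<F> = X"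
    "\<And>F i p q. F \<in> \<F> \<Longrightarrow> i \<in> I \<Longrightarrow> p \<in> F \<Longrightarrow> q \<in> F \<Longrightarrow> \<bar>\<phi> i p - \<phi> i q\<bar> < 2 * \<delta>"
proof -
  \<comment> \<open>The roles are exchanged: the points of \<open>X\<close> are now the objects
    classified by their values under the finitely many \<open>\<phi> i\<close>. Finiteness of the
    cover thus comes from bounded values, not from compactness of \<open>X\<close>.\<close>
  obtain P where P: "finite P" "P \<subseteq> X" "\<And>p. p \<in> X \<Longrightarrow> \<exists>p'\<in>P. \<forall>i\<in>I. \<bar>\<phi> i p - \<phi> i p'\<bar> < \<delta>"
    using finite_net_of_bounded_family[of I X \<phi> B \<delta>] assms by metis
  \<comment> \<open>Intersecting with the whole space keeps \<open>U p'\<close> inside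
    \<open>X\<close> when \<open>I\<close> is empty.\<close>
  define U where "U p' = (\<Inter>i\<in>I. X \<inter> \<phi> i -` ball (\<phi> i p') \<delta>) \<inter> topspace (top_of_set X)" for p'
  have U: "p \<in> U p' \<longleftrightarrow> p \<in> X \<and> (\<forall>i\<in>I. \<bar>\<phi> i p - \<phi> i p'\<bar> < \<delta>)" for p p'
    by (auto simp: U_def dist_real_def abs_minus_commute)
  show thesis
  proof (rule that[of "U ` P"])
    show "finite (U ` P)" using P(1) by simp
    show "openin (top_of_set X) F" if "F \<in> U ` P" for F
    proof -
      have "openin (top_of_set X) (U p')" for p'
        unfolding U_def
        by (intro openin_INT assms(1) continuous_openin_preimage_gen assms(2)) auto
      then show ?thesis using that by blast
    qed
    show "\<Union>(U ` P) = X" using P(3) by (auto simp: U)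
    show "\<bar>\<phi> i p - \<phi> i q\<bar> < 2 * \<delta>" if "F \<in> U ` P" "i \<in> I" "p \<in> F" "q \<in> F" for F i p q
    proof -
      from that(1) obtain p' where "F = U p'" by blast
      then have "\<bar>\<phi> i p - \<phi> i p'\<bar> < \<delta>" "\<bar>\<phi> i q - \<phi> i p'\<bar> < \<delta>" using that U by blast+
      then show ?thesis by linarith
    qed
  qed
qed

lemma continuous_on_hoelder_diff:
  assumes "continuous_on A g"
  shows "continuous_on (off_diagonal A) (hoelder_diff \<alpha> g)"
proof -
  have "continuous_on (off_diagonal A)
      (\<lambda>p. (g (fst p) - g (snd p)) / norm (fst p - snd p) powr \<alpha>)"
    by (intro continuous_intros continuous_on_compose2[OF assms]) (auto simp: off_diagonal_def)
  then show ?thesis by (simp add: hoelder_diff_def case_prod_beta')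
qed

lemma schauder_bounded_finite:
  assumes "bounded \<Omega>" "finite K" "K \<subseteq> schauder_space m \<alpha> \<Omega>"
  shows "schauder_bounded m \<alpha> \<Omega> K"
proof -
  have "(SUP k\<in>K. schauder_norm m \<alpha> \<Omega> k) \<le> (\<Sum>k\<in>K. schauder_norm m \<alpha> \<Omega> k)"
    using assms(2) by (intro SUP_least member_le_sum) auto
  also have "\<dots> < \<infinity>"
    using schauder_norm_finite[OF assms(1) subsetD[OF assms(3)]]
    by (simp add: infinity_ennreal_def assms(2))
  finally show ?thesis by (simp add: schauder_bounded_def)
qed

section \<open>The compactness criterion\<close>

theorem theorem2p5:
  fixes \<Omega> :: "(real ^ 'n::finite) set" and \<alpha> :: real and m :: nat
    and K :: "(real ^ 'n \<Rightarrow> real) set"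
  assumes "open \<Omega>" and "bounded \<Omega>" and "connected \<Omega>"
    and "geodesic_const \<Omega> < \<infinity>"
    and "0 < \<alpha>" and "\<alpha> \<le> 1" and "m \<noteq> 0"
    and "K \<subseteq> schauder_space m \<alpha> \<Omega>"
  shows "relatively_compact_in (schauder_topology m \<alpha> \<Omega>) K \<longleftrightarrow>
    schauder_bounded m \<alpha> \<Omega> K \<and>
    (\<forall>\<epsilon>>0. \<exists>\<F>. finite \<F> \<and>
       (\<forall>F\<in>\<F>. openin (top_of_set (off_diagonal \<Omega>)) F) \<and>
       \<Union>\<F> = off_diagonal \<Omega> \<and>
       (\<forall>F\<in>\<F>. \<forall>k\<in>K. \<forall>\<eta>. multi_order \<eta> = m \<longrightarrow>
          diameter (hoelder_diff \<alpha> (cl_D \<Omega> \<eta> k) ` F) < \<epsilon>))"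
    (is "_ \<longleftrightarrow> schauder_bounded m \<alpha> \<Omega> K \<and> ?cover")
proof -
  interpret Metric_space "schauder_space m \<alpha> \<Omega>" "schauder_dist m \<alpha> \<Omega>"
    by (rule schauder_metric[OF assms(1,2)])
  have sub: "\<Omega> \<subseteq> closure \<Omega>" "off_diagonal \<Omega> \<subseteq> off_diagonal (closure \<Omega>)"
    using closure_subset off_diagonal_mono by blast+
  have "relatively_compact_in (schauder_topology m \<alpha> \<Omega>) K \<longleftrightarrow> mtotally_bounded K"
    using mtotally_bounded_eq_compact_closure_of[OF schauder_complete[OF assms(1,2,5)]] assms(8)
    by (simp add: relatively_compact_in_def)
  also have "mtotally_bounded K \<longleftrightarrow> schauder_bounded m \<alpha> \<Omega> K \<and> ?cover"
  proof (intro iffI conjI)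
    assume tb: "mtotally_bounded K"
    have net: "\<exists>K'. finite K' \<and> K' \<subseteq> K \<and> (\<forall>k\<in>K. \<exists>k'\<in>K'. schauder_dist m \<alpha> \<Omega> k k' < \<epsilon>)"
      if \<epsilon>: "\<epsilon> > 0" for \<epsilon>
    proof -
      obtain K' where "finite K'" "K' \<subseteq> K" "K \<subseteq> (\<Union>x\<in>K'. mball x \<epsilon>)"
        using tb \<epsilon> unfolding mtotally_bounded_def by meson
      moreover have "\<exists>k'\<in>K'. schauder_dist m \<alpha> \<Omega> k k' < \<epsilon>" if "k \<in> K" for k
        using subsetD[OF calculation(3) that] commute by auto
      ultimately show ?thesis by blast
    qed
    note ge = schauder_dist_ge[OF assms(1,2)]
    show "schauder_bounded m \<alpha> \<Omega> K"
    proof -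
      obtain K' where K': "finite K'" "K' \<subseteq> K"
        "\<And>k. k \<in> K \<Longrightarrow> \<exists>k'\<in>K'. schauder_dist m \<alpha> \<Omega> k k' < 1"
        using net[OF zero_less_one] by blast
      then have "schauder_bounded m \<alpha> \<Omega> K'"
        using assms(2,8) by (intro schauder_bounded_finite) auto
      then obtain B where B: "0 \<le> B"
        "\<And>k \<eta> x. k \<in> K' \<Longrightarrow> multi_order \<eta> \<le> m \<Longrightarrow> x \<in> closure \<Omega> \<Longrightarrow> \<bar>cl_D \<Omega> \<eta> k x\<bar> \<le> B"
        "\<And>k \<eta> p. k \<in> K' \<Longrightarrow> multi_order \<eta> = m \<Longrightarrow> p \<in> off_diagonal (closure \<Omega>) \<Longrightarrow>
          \<bar>hoelder_diff \<alpha> (cl_D \<Omega> \<eta> k) p\<bar> \<le> B"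
        using schauder_bounded_obtain by blast
      \<comment> \<open>Every member of \<open>K\<close> is within 1 of a net member bounded by
        \<open>B\<close>, so \<open>B + 1\<close> bounds all its derivatives and quotients,
        independently of \<open>k\<close>.\<close>
      have "schauder_norm m \<alpha> \<Omega> k \<le> ennreal (num_evals TYPE('n) m * (B + 1))" if k: "k \<in> K" for k
      proof -
        obtain k' where k': "k' \<in> K'" "schauder_dist m \<alpha> \<Omega> k k' < 1" using K'(3)[OF k] by blast
        have M: "k \<in> schauder_space m \<alpha> \<Omega>" "k' \<in> schauder_space m \<alpha> \<Omega>"
          using k k'(1) K'(2) assms(8) by auto
        show ?thesis
        proof (rule schauder_norm_le[OF assms(5)])
          fix \<eta> :: "'n \<Rightarrow> nat" and x assume "multi_order \<eta> \<le> m" "x \<in> \<Omega>"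
          then show "\<bar>cl_D \<Omega> \<eta> k x\<bar> \<le> B + 1"
            using ge(1)[OF M, of \<eta> x] B(2)[OF k'(1), of \<eta> x] k'(2) sub(1) by (auto simp: subset_iff)
        next
          fix \<eta> :: "'n \<Rightarrow> nat" and p assume "multi_order \<eta> = m" "p \<in> off_diagonal \<Omega>"
          then have "\<bar>hoelder_diff \<alpha> (cl_D \<Omega> \<eta> k) p - hoelder_diff \<alpha> (cl_D \<Omega> \<eta> k') p\<bar> \<le> schauder_dist m \<alpha> \<Omega> k k'"
            "\<bar>hoelder_diff \<alpha> (cl_D \<Omega> \<eta> k') p\<bar> \<le> B"
            using ge(2)[OF M, of \<eta> p] B(3)[OF k'(1), of \<eta> p] sub(2) by blast+
          then show "\<bar>hoelder_diff \<alpha> (cl_D \<Omega> \<eta> k) p\<bar> \<le> B + 1"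
            using k'(2) by linarith
        qed (use B(1) M in \<open>auto simp: schauder_space_def\<close>)
      qed
      then have "(SUP k\<in>K. schauder_norm m \<alpha> \<Omega> k) \<le> ennreal (num_evals TYPE('n) m * (B + 1))"
        by (rule SUP_least)
      then show ?thesis
        unfolding schauder_bounded_def infinity_ennreal_def using ennreal_less_top le_less_trans by blast
    qed
    show ?cover
    proof (intro allI impI)
      fix \<epsilon> :: real assume \<epsilon>: "\<epsilon> > 0"
      \<comment> \<open>Oscillation \<open>2 * \<delta>\<close> for a net member and
        \<open>\<delta>\<close> at each of two points for passing to it give
        \<open>4 * \<delta>\<close>, half of \<open>\<epsilon>\<close>; the slack keeps the diameter
        strictly below \<open>\<epsilon>\<close>.\<close>
      define \<delta> where "\<delta> = \<epsilon> / 8"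
      have \<delta>: "\<delta> > 0" using \<epsilon> by (simp add: \<delta>_def)
      obtain K' where K': "finite K'" "K' \<subseteq> K"
        "\<And>k. k \<in> K \<Longrightarrow> \<exists>k'\<in>K'. schauder_dist m \<alpha> \<Omega> k k' < \<delta>"
        using net[OF \<delta>] by blast
      have K'M: "K' \<subseteq> schauder_space m \<alpha> \<Omega>" using K'(2) assms(8) by blast
      obtain B where B: "\<And>k \<eta> p. k \<in> K' \<Longrightarrow> multi_order \<eta> = m \<Longrightarrow> p \<in> off_diagonal (closure \<Omega>) \<Longrightarrow>
          \<bar>hoelder_diff \<alpha> (cl_D \<Omega> \<eta> k) p\<bar> \<le> B"
        by (rule schauder_bounded_obtain[OF schauder_bounded_finite[OF assms(2) K'(1) K'M]]) (rule that)
      define \<phi> where "\<phi> = (\<lambda>(k, \<eta>). hoelder_diff \<alpha> (cl_D \<Omega> \<eta> k))"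
      \<comment> \<open>Indexing by both net member and multi-index lets a single cover serve them
        all.\<close>
      let ?I = "K' \<times> {\<eta>. multi_order \<eta> = m}"
      have "finite ?I" using K'(1) by (simp add: finite_multi_order)
      moreover have "continuous_on (off_diagonal \<Omega>) (\<phi> i)" if "i \<in> ?I" for i
      proof -
        have "continuous_on (closure \<Omega>) (cl_D \<Omega> (snd i) (fst i))"
          using that K'M by (intro cl_D_continuous[of _ m]) (auto simp: schauder_space_def)
        from continuous_on_subset[OF continuous_on_hoelder_diff[OF this] sub(2)]
        show ?thesis by (simp add: \<phi>_def case_prod_beta')
      qed
      moreover have "\<bar>\<phi> i p\<bar> \<le> B" if "i \<in> ?I" "p \<in> off_diagonal \<Omega>" for i p
        using that(1) B[of _ _ p] subsetD[OF sub(2) that(2)] by (auto simp: \<phi>_def simp del: split_paired_All)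
      ultimately obtain \<F> where F: "finite \<F>" "\<And>F. F \<in> \<F> \<Longrightarrow> openin (top_of_set (off_diagonal \<Omega>)) F"
        "\<Union>\<F> = off_diagonal \<Omega>"
        "\<And>F i p q. F \<in> \<F> \<Longrightarrow> i \<in> ?I \<Longrightarrow> p \<in> F \<Longrightarrow> q \<in> F \<Longrightarrow> \<bar>\<phi> i p - \<phi> i q\<bar> < 2 * \<delta>"
        by (rule finite_open_cover_small_oscillation[of ?I "off_diagonal \<Omega>" \<phi> B \<delta>]) (use \<delta> in auto)
      have "diameter (hoelder_diff \<alpha> (cl_D \<Omega> \<eta> k) ` F) < \<epsilon>"
        if "F \<in> \<F>" "k \<in> K" "multi_order \<eta> = m" for F k \<eta>
      proof -
        from K'(3)[OF that(2)] obtain k' where k': "k' \<in> K'" "schauder_dist m \<alpha> \<Omega> k k' < \<delta>" by blast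
        have M: "k \<in> schauder_space m \<alpha> \<Omega>" "k' \<in> schauder_space m \<alpha> \<Omega>"
          using that(2) k'(1) K'M assms(8) by auto
        let ?g = "hoelder_diff \<alpha> (cl_D \<Omega> \<eta> k)" and ?g' = "hoelder_diff \<alpha> (cl_D \<Omega> \<eta> k')"
        have near: "\<bar>?g p - ?g' p\<bar> < \<delta>" if "p \<in> F" for p
        proof -
          have "p \<in> off_diagonal (closure \<Omega>)" using that \<open>F \<in> \<F>\<close> F(3) sub(2) by blast
          from ge(2)[OF M \<open>multi_order \<eta> = m\<close> this] k'(2) show ?thesis by linarith
        qed
        have "diameter (?g ` F) \<le> 4 * \<delta>"
        proof (rule diameter_le)
          show "?g ` F \<noteq> {} \<or> 0 \<le> 4 * \<delta>" using \<delta> by simp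
          fix a b assume "a \<in> ?g ` F" "b \<in> ?g ` F"
          then obtain p q where pq: "p \<in> F" "q \<in> F" "a = ?g p" "b = ?g q" by blast
          have "\<bar>?g' p - ?g' q\<bar> < 2 * \<delta>"
            using F(4)[OF that(1), of "(k', \<eta>)" p q] k'(1) that(3) pq(1,2) by (simp add: \<phi>_def)
          then show "norm (a - b) \<le> 4 * \<delta>"
            using near[OF pq(1)] near[OF pq(2)] pq(3,4) unfolding real_norm_def by linarith
        qed
        then show ?thesis using \<epsilon> by (simp add: \<delta>_def)
      qed
      then show "\<exists>\<F>. finite \<F> \<and> (\<forall>F\<in>\<F>. openin (top_of_set (off_diagonal \<Omega>)) F) \<and>
          \<Union>\<F> = off_diagonal \<Omega> \<and> (\<forall>F\<in>\<F>. \<forall>k\<in>K. \<forall>\<eta>. multi_order \<eta> = m \<longrightarrow>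
            diameter (hoelder_diff \<alpha> (cl_D \<Omega> \<eta> k) ` F) < \<epsilon>)"
        using F(1-3) by (intro exI[of _ \<F>]) simp
    qed
  next
    assume "schauder_bounded m \<alpha> \<Omega> K \<and> ?cover"
    then have bdd: "schauder_bounded m \<alpha> \<Omega> K" and cover: ?cover by auto
    show "mtotally_bounded K"
      unfolding mtotally_bounded_def
    proof (intro allI impI)
      fix \<epsilon> :: real assume \<epsilon>: "\<epsilon> > 0"
      let ?N = "real (num_evals TYPE('n) m)"
      \<comment> \<open>The net is accurate to \<open>?N * (3 * \<delta>)\<close>, which is then
        \<open>\<epsilon> * ?N / (?N + 1)\<close>, strictly below \<open>\<epsilon>\<close>.\<close>
      define \<delta> where "\<delta> = \<epsilon> / (3 * (?N + 1))"
      have \<delta>: "\<delta> > 0" "?N * (3 * \<delta>) < \<epsilon>"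
        using \<epsilon> by (auto simp: \<delta>_def field_simps add_nonneg_pos)
      obtain \<F> where F: "finite \<F>" "\<Union>\<F> = off_diagonal \<Omega>"
        "\<forall>F\<in>\<F>. \<forall>k\<in>K. \<forall>\<eta>. multi_order \<eta> = m \<longrightarrow>
          diameter (hoelder_diff \<alpha> (cl_D \<Omega> \<eta> k) ` F) < \<delta>"
        using cover[rule_format, OF \<delta>(1)] by (elim exE conjE) (rule that)
      obtain K' where K': "finite K'" "K' \<subseteq> K"
        "\<And>k. k \<in> K \<Longrightarrow> \<exists>k'\<in>K'. schauder_dist m \<alpha> \<Omega> k k' \<le> ?N * (3 * \<delta>)"
        by (rule schauder_finite_net[OF assms(1,2,4,5,8) bdd \<delta>(1) F(1,2) F(3)[rule_format]]) (assumption+, rule that)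
      have "K \<subseteq> (\<Union>x\<in>K'. mball x \<epsilon>)"
      proof
        fix k assume k: "k \<in> K"
        then obtain k' where k': "k' \<in> K'" "schauder_dist m \<alpha> \<Omega> k k' < \<epsilon>"
          using K'(3) \<delta>(2) le_less_trans by blast
        then show "k \<in> (\<Union>x\<in>K'. mball x \<epsilon>)"
          using k K'(2) assms(8) by (auto simp: commute)
      qed
      then show "\<exists>K'. finite K' \<and> K' \<subseteq> K \<and> K \<subseteq> (\<Union>x\<in>K'. mball x \<epsilon>)"
        using K'(1,2) by blast
    qed
  qed
  finally show ?thesis .
qed

end
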